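(* For every binary radix system $(\Gamma,\pi,B)$ there is an admissible non-null pair $(\alpha,\beta)$ such that either $R(\alpha,\beta,-)=(\Gamma,\pi,B)$ or $R(\alpha,\beta,+)=(\Gamma,\pi,B)$.
   Context: Let $\Omega=\{0,1\}^{\infty}$ be the set of infinite strings $\omega=\omega_0\omega_1\omega_2\cdots$ with $\omega_n\in\{0,1\}$. The shift $S:\Omega\to\Omega$ is $S(\omega_0\omega_1\omega_2\cdots)=\omega_1\omega_2\cdots$, $S^n$ its $n$-th iterate. Lexicographic order on $\Omega$: $\sigma\prec\omega$ if $\sigma\neq\omega$ and $\sigma_k<\omega_k$ at the least index $k$ with $\sigma_k\neq\omega_k$; intervals $[\alpha,\beta]=\{\omega:\alpha\preceq\omega\preceq\beta\}$, and similarly $(\alpha,\beta]$, $[\alpha,\beta)$. Decimals: $\Omega^{\bullet}$ is the set of decimals $\omega_0\cdots\omega_N\bullet\omega_{N+1}\cdots$ obtained from an element of $\Omega$ by inserting a decimal point (initial zeros before the point may be added or omitted). For $\omega\in\Omega^{\bullet}$, $\widehat\omega\in\Omega$ is $\omega$ with the point removed; for $\Gamma\subseteq\Omega^{\bullet}$, $\widehat\Gamma=\{\widehat\omega:\omega\in\Gamma\}$; for $\Gamma\subseteq\Omega$, $\Gamma^{\bullet}$ is the set of all decimals obtained from strings of $\Gamma$ by placing the point anywhere. $\Gamma\subseteq\Omega^{\bullet}$ is shift invariant if $[S^n(\widehat\Gamma)]^{\bullet}=\Gamma$ for all $n\ge0$. Order on $\Omega^{\bullet}$: writing two decimals (padding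 with leading zeros) with the point after the same position, $\sigma\prec\omega$ iff $\sigma\ne\omega$ and $\widehat\sigma\prec\widehat\omega$. A binary radix system is a triple $(\Gamma,\pi,B)$ with $B>1$ real, $\Gamma\subseteq\Omega^{\bullet}$, $\pi:\Gamma\to[0,\infty)$, such that (i) $\Gamma$ is shift invariant, (ii) $\pi$ is bijective and strictly increasing, (iii) $\pi(\omega_0\cdots\omega_N\bullet\omega_{N+1}\cdots)=\sum_{n=-\infty}^{N}\omega_{N-n}B^n$ for all elements of $\Gamma$. A pair $(\alpha,\beta)$ in $\Omega$ is admissible if $\alpha_0=0,\alpha_1=1,\beta_0=1,\beta_1=0$, and $S^n\alpha\notin(\alpha,\beta]$, $S^n\beta\notin[\alpha,\beta)$ for all $n\ge0$. Define $\Omega_{(\alpha,\beta,-)}=\{\omega: S^n\omega\notin(\alpha,\beta]\ \forall n\ge0\}$, $\Omega_{(\alpha,\beta,+)}=\{\omega: S^n\omega\notin[\alpha,\beta)\ \forall n\ge0\}$, $\Omega_{(\alpha,\beta)}=\Omega_{(\alpha,\beta,-)}\cup\Omega_{(\alpha,\beta,+)}$, $\Omega^0_{(\alpha,\beta,-)}=\{\omega\in\Omega_{(\alpha,\beta,-)}:0\omega\preceq\alpha\}$, $\Omega^0_{(\alpha,\beta,+)}=\{\omega\in\Omega_{(\alpha,\beta,+)}:0\omega\prec\alpha\}$, and $\Omega^{\bullet}_{(\alpha,\beta,\pm)}=[\Omega^0_{(\alpha,\beta,\pm)}]^{\bullet}$. For $\Gamma\subseteq\Omega$ let $\Gamma_n=\{\gamma_0\cdots\gamma_{n-1}:\gamma\in\Gamma\}$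 and $h(\Gamma)=\limsup_{n}\frac1n\ln|\Gamma_n|$; the pair is null if $h(\Omega_{(\alpha,\beta)})=0$ and non-null otherwise. For an admissible non-null pair, let $b$ be the minimum solution in $[\tfrac12,1)$ of $\sum_{n\ge0}\alpha_nx^n=\sum_{n\ge0}\beta_nx^n$ (such a solution exists), $B_{(\alpha,\beta)}=1/b$, $\pi_{(\alpha,\beta)}(\omega_0\cdots\omega_N\bullet\omega_{N+1}\cdots)=\sum_{n=-\infty}^{N}\omega_{N-n}B_{(\alpha,\beta)}^n$, and $R(\alpha,\beta,\pm)=(\Omega^{\bullet}_{(\alpha,\beta,\pm)},\pi_{(\alpha,\beta)},B_{(\alpha,\beta)})$ (the $(\alpha,\beta)$-radix systems). *)

theory Defs
  imports "HOL-Analysis.Analysis" "HOL-Library.Fun_Lexorder"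
begin

type_synonym bstring = "nat \<Rightarrow> bool"

definition shift :: "bstring \<Rightarrow> bstring" where
  "shift \<omega> = (\<lambda>n. \<omega> (Suc n))"

definition cons0 :: "bstring \<Rightarrow> bstring" where
  "cons0 \<omega> = case_nat False \<omega>"

text \<open>The lexicographic order is the library's \<^const>\<open>less_fun\<close>; the order \<open><\<close> on functions is
  pointwise and is not used.\<close>

definition lex_le :: "bstring \<Rightarrow> bstring \<Rightarrow> bool" where
  "lex_le \<sigma> \<omega> \<longleftrightarrow> less_fun \<sigma> \<omega> \<or> \<sigma> = \<omega>"

definition lex_oc :: "bstring \<Rightarrow> bstring \<Rightarrow> bstring set" where
  "lex_oc \<alpha> \<beta> = {\<omega>. less_fun \<alpha> \<omega> \<and> lex_le \<omega> \<beta>}"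

definition lex_co :: "bstring \<Rightarrow> bstring \<Rightarrow> bstring set" where
  "lex_co \<alpha> \<beta> = {\<omega>. lex_le \<alpha> \<omega> \<and> less_fun \<omega> \<beta>}"

text \<open>A decimal is recorded by its digits, \<open>d n\<close> being the coefficient of \<open>B\<^sup>n\<close>, so that
  two ways of writing a decimal which differ only in initial zeros give the same object
  (lemma \<open>point_at_eq_iff\<close>).  The decimals are exactly the functions
  \<open>point_at N \<omega>\<close>, where the point is inserted in \<open>\<omega>\<close> after the digit with index \<open>N\<close>.\<close>

type_synonym decimal = "int \<Rightarrow> bool"

definition point_at :: "nat \<Rightarrow> bstring \<Rightarrow> decimal" where
  "point_at N \<omega> = (\<lambda>n. n \<le> int N \<and> \<omega> (nat (int N - n)))"

lemma point_at_eq_iff: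
  "point_at N \<sigma> = point_at (N + m) \<omega> \<longleftrightarrow> \<omega> = (cons0 ^^ m) \<sigma>"
proof -
  have cons0_pow: "(cons0 ^^ m) \<sigma> k \<longleftrightarrow> m \<le> k \<and> \<sigma> (k - m)" for k
    by (induction m arbitrary: k) (auto simp: cons0_def split: nat.split)
  show ?thesis
  proof
    assume eq: "point_at N \<sigma> = point_at (N + m) \<omega>"
    show "\<omega> = (cons0 ^^ m) \<sigma>"
    proof
      fix k
      from fun_cong[OF eq, of "int (N + m) - int k"]
      show "\<omega> k = (cons0 ^^ m) \<sigma> k"
        by (cases "m \<le> k") (auto simp: point_at_def cons0_pow nat_diff_distrib)
    qed
  next
    assume w: "\<omega> = (cons0 ^^ m) \<sigma>"
    show "point_at N \<sigma> = point_at (N + m) \<omega>"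
    proof
      fix n :: int
      have "m \<le> nat (int N + int m - n) \<longleftrightarrow> n \<le> int N" if "n \<le> int N + int m"
        using that by linarith
      moreover have "nat (int N + int m - n) - m = nat (int N - n)"
        by linarith
      ultimately show "point_at N \<sigma> n = point_at (N + m) \<omega> n"
        by (auto simp: point_at_def w cons0_pow)
    qed
  qed
qed

definition dot :: "bstring set \<Rightarrow> decimal set" where
  "dot \<Gamma> = {point_at N \<omega> | N \<omega>. \<omega> \<in> \<Gamma>}"

text \<open>Since initial zeros may be added or omitted, removing the point is applied to every way of
  writing a decimal.\<close>

definition hat :: "decimal set \<Rightarrow> bstring set" where
  "hat \<Gamma> = {\<omega>. \<exists>N. point_at N \<omega> \<in> \<Gamma>}"

definition shift_invariant :: "decimal set \<Rightarrow> bool" where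
  "shift_invariant \<Gamma> \<longleftrightarrow> (\<forall>n. dot ((shift ^^ n) ` hat \<Gamma>) = \<Gamma>)"

definition dec_less :: "decimal \<Rightarrow> decimal \<Rightarrow> bool" where
  "dec_less d e \<longleftrightarrow>
     (\<exists>N \<sigma> \<omega>. d = point_at N \<sigma> \<and> e = point_at N \<omega> \<and> d \<noteq> e \<and> less_fun \<sigma> \<omega>)"

definition dec_value :: "real \<Rightarrow> decimal \<Rightarrow> real" where
  "dec_value B d = (\<Sum>\<^sub>\<infinity>n. of_bool (d n) * B powi n)"

lemma dec_value_point_at:
  "dec_value B (point_at N \<omega>) = (\<Sum>\<^sub>\<infinity>n\<in>{..int N}. of_bool (\<omega> (nat (int N - n))) * B powi n)"
  unfolding dec_value_def by (rule infsum_cong_neutral) (auto simp: point_at_def)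

text \<open>A function with domain \<open>\<Gamma>\<close> is represented by its extension with the value
  \<^const>\<open>undefined\<close> outside \<open>\<Gamma>\<close>, so that radix systems can be compared by equality of triples.\<close>

definition binary_radix_system :: "decimal set \<Rightarrow> (decimal \<Rightarrow> real) \<Rightarrow> real \<Rightarrow> bool" where
  "binary_radix_system \<Gamma> \<pi> B \<longleftrightarrow>
     B > 1 \<and> \<Gamma> \<subseteq> dot UNIV \<and> \<pi> \<in> \<Gamma> \<rightarrow>\<^sub>E {0..} \<and>
     shift_invariant \<Gamma> \<and>
     bij_betw \<pi> \<Gamma> {0..} \<and> monotone_on \<Gamma> dec_less (<) \<pi> \<and>
     (\<forall>d\<in>\<Gamma>. \<pi> d = dec_value B d)"

definition admissible :: "bstring \<Rightarrow> bstring \<Rightarrow> bool" where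
  "admissible \<alpha> \<beta> \<longleftrightarrow>
     \<not> \<alpha> 0 \<and> \<alpha> 1 \<and> \<beta> 0 \<and> \<not> \<beta> 1 \<and>
     (\<forall>n. (shift ^^ n) \<alpha> \<notin> lex_oc \<alpha> \<beta> \<and> (shift ^^ n) \<beta> \<notin> lex_co \<alpha> \<beta>)"

definition Omega_minus :: "bstring \<Rightarrow> bstring \<Rightarrow> bstring set" where
  "Omega_minus \<alpha> \<beta> = {\<omega>. \<forall>n. (shift ^^ n) \<omega> \<notin> lex_oc \<alpha> \<beta>}"

definition Omega_plus :: "bstring \<Rightarrow> bstring \<Rightarrow> bstring set" where
  "Omega_plus \<alpha> \<beta> = {\<omega>. \<forall>n. (shift ^^ n) \<omega> \<notin> lex_co \<alpha> \<beta>}"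

definition Omega_pair :: "bstring \<Rightarrow> bstring \<Rightarrow> bstring set" where
  "Omega_pair \<alpha> \<beta> = Omega_minus \<alpha> \<beta> \<union> Omega_plus \<alpha> \<beta>"

definition Omega0_minus :: "bstring \<Rightarrow> bstring \<Rightarrow> bstring set" where
  "Omega0_minus \<alpha> \<beta> = {\<omega> \<in> Omega_minus \<alpha> \<beta>. lex_le (cons0 \<omega>) \<alpha>}"

definition Omega0_plus :: "bstring \<Rightarrow> bstring \<Rightarrow> bstring set" where
  "Omega0_plus \<alpha> \<beta> = {\<omega> \<in> Omega_plus \<alpha> \<beta>. less_fun (cons0 \<omega>) \<alpha>}"

definition initial_words :: "bstring set \<Rightarrow> nat \<Rightarrow> bool list set" where
  "initial_words \<Gamma> n = (\<lambda>\<gamma>. map \<gamma> [0..<n]) ` \<Gamma>"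

definition entropy :: "bstring set \<Rightarrow> ereal" where
  "entropy \<Gamma> = limsup (\<lambda>n. ereal (1 / real n * ln (real (card (initial_words \<Gamma> n)))))"

definition null_pair :: "bstring \<Rightarrow> bstring \<Rightarrow> bool" where
  "null_pair \<alpha> \<beta> \<longleftrightarrow> entropy (Omega_pair \<alpha> \<beta>) = 0"

definition pair_base :: "bstring \<Rightarrow> bstring \<Rightarrow> real" where
  "pair_base \<alpha> \<beta> = 1 / (LEAST x. x \<in> {1/2..<1} \<and>
     (\<Sum>n. of_bool (\<alpha> n) * x ^ n) = (\<Sum>n. of_bool (\<beta> n) * x ^ n))"

definition R_minus :: "bstring \<Rightarrow> bstring \<Rightarrow> decimal set \<times> (decimal \<Rightarrow> real) \<times> real" where
  "R_minus \<alpha> \<beta> =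
     (dot (Omega0_minus \<alpha> \<beta>),
      restrict (dec_value (pair_base \<alpha> \<beta>)) (dot (Omega0_minus \<alpha> \<beta>)),
      pair_base \<alpha> \<beta>)"

definition R_plus :: "bstring \<Rightarrow> bstring \<Rightarrow> decimal set \<times> (decimal \<Rightarrow> real) \<times> real" where
  "R_plus \<alpha> \<beta> =
     (dot (Omega0_plus \<alpha> \<beta>),
      restrict (dec_value (pair_base \<alpha> \<beta>)) (dot (Omega0_plus \<alpha> \<beta>)),
      pair_base \<alpha> \<beta>)"

end

theory Submission
  imports Defs
begin

text \<open>
  Let \<open>H\<close> be the set of strings of a radix system and \<open>v \<omega> = (\<Sum>n. \<omega>\<^sub>n B\<^bsup>-n\<^esup>)\<close>. Shift invariance and
  monotonicity force \<open>v\<close> to map \<open>H\<close> bijectively onto an interval \<open>[0, M]\<close> or \<open>[0, M)\<close>, and prefixing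
  a zero identifies the strings of \<open>H\<close> with first digit 0 with the values up to \<open>c = M / B\<close>. So
  every string of \<open>H\<close> is the itinerary of its value under the map \<open>y \<mapsto> B y\<close> below \<open>c\<close>,
  \<open>y \<mapsto> B (y - 1)\<close> above \<open>c\<close>, and \<open>\<alpha>\<close>, \<open>\<beta>\<close> are the two itineraries of \<open>c\<close>. Lexicographic
  comparison with \<open>\<alpha>\<close> and \<open>\<beta>\<close> characterises the itineraries. Words of length \<open>n\<close> determine a value
  up to \<open>M B\<^bsup>-n\<^esup>\<close>, so there are at least of order \<open>B\<^sup>n\<close> of them and the entropy is positive.
\<close>

section \<open>Binary strings and the values they represent\<close>

lemma funpow_shift: "(shift ^^ n) \<omega> k = \<omega> (n + k)"
  by (induction n arbitrary: \<omega> k) (simp_all add: shift_def)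

lemma funpow_shift_Suc: "(shift ^^ n) (shift \<omega>) = (shift ^^ Suc n) \<omega>"
  by (simp add: funpow_swap1)

lemma shift_cons0 [simp]: "shift (cons0 \<omega>) = \<omega>"
  by (simp add: shift_def cons0_def)

lemma cons0_0 [simp]: "\<not> cons0 \<omega> 0"
  by (simp add: cons0_def)

lemma bstring_eq_iff: "\<sigma> = \<omega> \<longleftrightarrow> \<sigma> 0 = \<omega> 0 \<and> shift \<sigma> = shift \<omega>"
proof -
  have "\<sigma> k = \<omega> k" if "\<sigma> 0 = \<omega> 0" "shift \<sigma> = shift \<omega>" for k
    using that(1) fun_cong[OF that(2), of "k - 1"] by (cases k) (auto simp: shift_def)
  then show ?thesis by auto
qed

lemma less_fun_unfold:
  fixes \<sigma> \<omega> :: bstring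
  shows "less_fun \<sigma> \<omega> \<longleftrightarrow> (\<not> \<sigma> 0 \<and> \<omega> 0) \<or> (\<sigma> 0 = \<omega> 0 \<and> less_fun (shift \<sigma>) (shift \<omega>))"
proof
  assume "less_fun \<sigma> \<omega>"
  then obtain k where k: "\<sigma> k < \<omega> k" "\<And>j. j < k \<Longrightarrow> \<sigma> j = \<omega> j"
    unfolding less_fun_def by blast
  show "(\<not> \<sigma> 0 \<and> \<omega> 0) \<or> (\<sigma> 0 = \<omega> 0 \<and> less_fun (shift \<sigma>) (shift \<omega>))"
  proof (cases k)
    case 0
    then show ?thesis using k by auto
  next
    case (Suc i)
    then show ?thesis using k by (auto simp: less_fun_def shift_def intro!: exI[of _ i])
  qed
next
  assume "(\<not> \<sigma> 0 \<and> \<omega> 0) \<or> (\<sigma> 0 = \<omega> 0 \<and> less_fun (shift \<sigma>) (shift \<omega>))"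
  then show "less_fun \<sigma> \<omega>"
  proof
    assume "\<not> \<sigma> 0 \<and> \<omega> 0"
    then show ?thesis by (auto simp: less_fun_def intro!: exI[of _ 0])
  next
    assume *: "\<sigma> 0 = \<omega> 0 \<and> less_fun (shift \<sigma>) (shift \<omega>)"
    then obtain k where k: "\<sigma> (Suc k) < \<omega> (Suc k)" "\<And>j. j < k \<Longrightarrow> \<sigma> (Suc j) = \<omega> (Suc j)"
      by (auto simp: less_fun_def shift_def)
    have "\<sigma> j = \<omega> j" if "j < Suc k" for j
      using that * k by (cases j) auto
    then show ?thesis using k(1) by (auto simp: less_fun_def intro!: exI[of _ "Suc k"])
  qed
qed

lemma lex_le_unfold:
  "lex_le \<sigma> \<omega> \<longleftrightarrow> (\<not> \<sigma> 0 \<and> \<omega> 0) \<or> (\<sigma> 0 = \<omega> 0 \<and> lex_le (shift \<sigma>) (shift \<omega>))"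
  unfolding lex_le_def using less_fun_unfold[of \<sigma> \<omega>] bstring_eq_iff[of \<sigma> \<omega>] by blast

lemma less_fun_linear:
  fixes \<sigma> \<omega> :: bstring
  shows "less_fun \<sigma> \<omega> \<or> \<sigma> = \<omega> \<or> less_fun \<omega> \<sigma>"
proof (cases "\<sigma> = \<omega>")
  case False
  then obtain i where "\<sigma> i \<noteq> \<omega> i" by auto
  define k where "k = (LEAST i. \<sigma> i \<noteq> \<omega> i)"
  have "\<sigma> k \<noteq> \<omega> k" "\<And>j. j < k \<Longrightarrow> \<sigma> j = \<omega> j"
    unfolding k_def using LeastI[of "\<lambda>i. \<sigma> i \<noteq> \<omega> i", OF \<open>\<sigma> i \<noteq> \<omega> i\<close>] not_less_Least by auto
  then show ?thesis
    unfolding less_fun_def by (cases "\<sigma> k") (auto intro!: exI[of _ k])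
qed simp

lemma not_less_fun_iff: "\<not> less_fun \<sigma> \<omega> \<longleftrightarrow> lex_le \<omega> \<sigma>"
  unfolding lex_le_def using less_fun_linear[of \<sigma> \<omega>] less_fun_asym[of \<sigma> \<omega>] less_fun_irrefl[of \<sigma>] by blast

section \<open>Strings as power series with digits 0 and 1\<close>

definition strval :: "real \<Rightarrow> bstring \<Rightarrow> real" where
  "strval x \<omega> = (\<Sum>n. of_bool (\<omega> n) * x ^ n)"

lemma summable_strval:
  fixes x :: real
  assumes "0 \<le> x" "x < 1"
  shows "summable (\<lambda>n. of_bool (\<omega> n) * x ^ n)"
  by (rule summable_comparison_test'[where g = "\<lambda>n. x ^ n" and N = 0])
     (use assms in \<open>auto simp: summable_geometric\<close>)

lemma strval_unfold:
  assumes "0 \<le> x" "x < 1"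
  shows "strval x \<omega> = of_bool (\<omega> 0) + x * strval x (shift \<omega>)"
proof -
  have "(\<Sum>n. of_bool (\<omega> (Suc n)) * x ^ Suc n) = strval x \<omega> - of_bool (\<omega> 0)"
    unfolding strval_def using suminf_split_head[OF summable_strval[OF assms, of \<omega>]] by simp
  moreover have "(\<Sum>n. of_bool (\<omega> (Suc n)) * x ^ Suc n) = x * strval x (shift \<omega>)"
    unfolding strval_def shift_def
    by (subst suminf_mult[symmetric])
       (use summable_strval[OF assms, of "shift \<omega>"] in \<open>simp_all add: shift_def mult_ac\<close>)
  ultimately show ?thesis by simp
qed

lemma strval_nonneg: "0 \<le> x \<Longrightarrow> x < 1 \<Longrightarrow> 0 \<le> strval x \<omega>"
  unfolding strval_def by (rule suminf_nonneg[OF summable_strval]) auto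

lemma strval_le:
  assumes "0 \<le> x" "x < 1"
  shows "strval x \<omega> \<le> 1 / (1 - x)"
proof -
  have "strval x \<omega> \<le> (\<Sum>n. x ^ n)"
    unfolding strval_def
    by (rule suminf_le) (use assms in \<open>auto simp: summable_geometric summable_strval\<close>)
  then show ?thesis using assms by (simp add: suminf_geometric)
qed

lemma strval_split:
  assumes "0 \<le> x" "x < 1"
  shows "strval x \<omega> = (\<Sum>i<n. of_bool (\<omega> i) * x ^ i) + x ^ n * strval x ((shift ^^ n) \<omega>)"
proof (induction n)
  case (Suc n)
  then show ?case
    using strval_unfold[OF assms, of "(shift ^^ n) \<omega>"] funpow_shift[of n \<omega> 0]
    by (simp add: algebra_simps)
qed simp

text \<open>The limit step of the later arguments in which an error shrinks by a fixed factor at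
  each induction step.\<close>

lemma le_zero_of_le_geometric:
  fixes d :: real
  assumes "0 \<le> x" "x < 1" "\<And>n. d \<le> C * x ^ n"
  shows "d \<le> 0"
proof -
  have "(\<lambda>n. C * x ^ n) \<longlonglongrightarrow> C * 0"
    using assms by (intro tendsto_mult LIMSEQ_realpow_zero) auto
  then show ?thesis
    using LIMSEQ_le_const[of "\<lambda>n. C * x ^ n" 0 d] assms(3) by auto
qed

text \<open>Reindexing by \<open>n = N - k\<close> turns the sum over integer exponents into
  \<open>B ^ N\<close> times a power series in \<open>1 / B\<close>. Absolute convergence identifies
  the unordered sum with the series.\<close>

lemma dec_value_eq_strval:
  assumes "B > 1"
  shows "dec_value B (point_at N \<omega>) = B ^ N * strval (1 / B) \<omega>"
proof -
  have x: "0 \<le> 1 / B" "1 / B < 1" using assms by auto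
  let ?g = "\<lambda>n. of_bool (\<omega> n) * (1 / B) ^ n"
  have bij: "bij_betw (\<lambda>k. int N - int k) UNIV {..int N}"
    by (rule bij_betwI[where g = "\<lambda>n. nat (int N - n)"]) auto
  have "dec_value B (point_at N \<omega>)
      = (\<Sum>\<^sub>\<infinity>n\<in>{..int N}. of_bool (\<omega> (nat (int N - n))) * B powi n)"
    by (rule dec_value_point_at)
  also have "\<dots> = (\<Sum>\<^sub>\<infinity>k. of_bool (\<omega> k) * B powi (int N - int k))"
    by (subst infsum_reindex_bij_betw[OF bij, symmetric]) simp
  also have "\<dots> = (\<Sum>\<^sub>\<infinity>k. B ^ N * ?g k)"
    using assms by (intro infsum_cong) (simp add: power_int_diff power_divide)
  also have "\<dots> = B ^ N * (\<Sum>\<^sub>\<infinity>k. ?g k)"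
    by (rule infsum_cmult_right')
  also have "(\<Sum>\<^sub>\<infinity>k. ?g k) = strval (1 / B) \<omega>"
    unfolding strval_def
  proof (rule infsumI, rule norm_summable_imp_has_sum)
    show "summable (\<lambda>n. norm (?g n))"
      using summable_strval[OF x, of \<omega>] assms by simp
    show "?g sums (\<Sum>n. ?g n)"
      using summable_sums[OF summable_strval[OF x, of \<omega>]] .
  qed
  finally show ?thesis .
qed

locale radix_base =
  fixes B :: real
  assumes B_gt_1: "1 < B"
begin

abbreviation val :: "bstring \<Rightarrow> real" where "val \<equiv> strval (1 / B)"

lemma x_bounds: "0 \<le> 1 / B" "1 / B < 1"
  using B_gt_1 by auto

lemma val_unfold: "val \<omega> = of_bool (\<omega> 0) + val (shift \<omega>) / B"
  using strval_unfold[OF x_bounds, of \<omega>] by (simp only: times_divide_eq_left mult_1)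

lemma val_cons0: "val (cons0 \<omega>) = val \<omega> / B"
  by (subst val_unfold) simp

end

section \<open>Itineraries of an expanding map with one discontinuity\<close>

text \<open>On \<open>[0, M]\<close> the branches \<open>y \<mapsto> B * y\<close> and \<open>y \<mapsto> B * (y - 1)\<close> meet at the critical point
  \<open>M / B\<close>; the flag \<open>s\<close> tells whether the critical point belongs to the right-hand branch.\<close>

locale critical_map = radix_base B for B :: real +
  fixes M :: real
  assumes B_le_M: "B \<le> M" and right_branch_le: "B * (M - 1) \<le> M"
begin

definition c :: real where "c = M / B"

definition upper :: "bool \<Rightarrow> real \<Rightarrow> bool" where
  "upper s y \<longleftrightarrow> (if s then c \<le> y else c < y)"

definition T :: "bool \<Rightarrow> real \<Rightarrow> real" where
  "T s y = B * (y - of_bool (upper s y))"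

definition itin :: "bool \<Rightarrow> real \<Rightarrow> bstring" where
  "itin s y n = upper s ((T s ^^ n) y)"

definition \<alpha> :: bstring where "\<alpha> = itin False c"
definition \<beta> :: bstring where "\<beta> = itin True c"

section \<open>Position of the critical point\<close>

lemma one_le_c: "1 \<le> c"
  using B_gt_1 B_le_M by (simp add: c_def)

lemma c_less_M: "c < M"
proof -
  have "M * 1 < M * B" using B_gt_1 B_le_M by (intro mult_strict_left_mono) auto
  then show ?thesis using B_gt_1 by (simp add: c_def field_simps)
qed

text \<open>Places \<open>1 / B\<close> in the interval \<open>[1/2, 1)\<close> where the root is
  sought.\<close>

lemma B_le_2: "B \<le> 2"
proof -
  have "B * (B - 1) \<le> M * (B - 1)" using B_gt_1 B_le_M by (intro mult_right_mono) auto
  also have "\<dots> \<le> B * 1" using right_branch_le by (simp add: algebra_simps)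
  finally show ?thesis using B_gt_1 by simp
qed

lemma B_c: "B * c = M"
  using B_gt_1 by (simp add: c_def)

text \<open>The right branch sends \<open>c\<close> to \<open>M - B\<close>, so this inequality
  makes the second digit of \<open>\<beta>\<close> zero.\<close>

lemma M_minus_B_less_c: "M - B < c"
proof -
  have "B * (M - B) < M"
  proof -
    have "B * (M - B) = B * (M - 1) - B * (B - 1)" by (simp add: algebra_simps)
    moreover have "0 < B * (B - 1)" using B_gt_1 by simp
    ultimately show ?thesis using right_branch_le by linarith
  qed
  then show ?thesis using B_gt_1 by (simp add: c_def field_simps)
qed

lemma T_expand: "y = of_bool (upper s y) + T s y / B"
  using B_gt_1 by (simp add: T_def)

lemma T_range:
  assumes "0 \<le> y" "y \<le> M"
  shows "0 \<le> T s y" "T s y \<le> M"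
proof -
  have "B * y \<le> B * c" if "y \<le> c" using that B_gt_1 by (intro mult_left_mono) auto
  moreover have "B * (y - 1) \<le> B * (M - 1)" using assms B_gt_1 by (intro mult_left_mono) auto
  moreover have "0 \<le> B * (y - 1)" if "c \<le> y" using that one_le_c B_gt_1 by auto
  moreover have "0 \<le> B * y" using assms B_gt_1 by simp
  ultimately show "0 \<le> T s y" "T s y \<le> M"
    using right_branch_le B_c by (cases "upper s y"; force simp: T_def upper_def split: if_splits)+
qed

section \<open>Values and order of itineraries\<close>

lemma itin_0: "itin s y 0 = upper s y"
  by (simp add: itin_def)

lemma shift_itin: "shift (itin s y) = itin s (T s y)"
  by (rule ext) (simp add: shift_def itin_def funpow_swap1)

lemma itin_Suc: "itin s y (Suc k) = itin s (T s y) k"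
  using fun_cong[OF shift_itin[of s y], of k] by (simp add: shift_def)

lemma funpow_shift_itin: "(shift ^^ n) (itin s y) = itin s ((T s ^^ n) y)"
  by (induction n) (simp_all add: shift_itin)

lemma T_pow_range: "0 \<le> y \<Longrightarrow> y \<le> M \<Longrightarrow> 0 \<le> (T s ^^ n) y \<and> (T s ^^ n) y \<le> M"
  by (induction n) (auto simp: T_range)

text \<open>The point and the value of its itinerary satisfy the same recursion, so each step
  divides their difference by \<open>B\<close>, while the difference stays bounded on
  \<open>[0, M]\<close>.\<close>

lemma val_itin:
  assumes "0 \<le> y" "y \<le> M"
  shows "val (itin s y) = y"
proof -
  let ?C = "1 / (1 - 1 / B) + M"
  have "0 \<le> y \<Longrightarrow> y \<le> M \<Longrightarrow> \<bar>val (itin s y) - y\<bar> \<le> ?C * (1 / B) ^ n" for y n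
  proof (induction n arbitrary: y)
    case 0
    then show ?case
      using strval_nonneg[OF x_bounds, of "itin s y"] strval_le[OF x_bounds, of "itin s y"] by auto
  next
    case (Suc n)
    have "val (itin s y) - y = (val (itin s (T s y)) - T s y) / B"
      using val_unfold[of "itin s y"] T_expand[of y s]
      by (simp add: itin_0 shift_itin diff_divide_distrib)
    then have "\<bar>val (itin s y) - y\<bar> = \<bar>val (itin s (T s y)) - T s y\<bar> / B"
      using B_gt_1 by (simp add: abs_divide)
    also have "\<dots> \<le> (?C * (1 / B) ^ n) / B"
      using Suc.IH[OF T_range[OF Suc.prems]] B_gt_1 by (intro divide_right_mono) auto
    finally show ?case by simp
  qed
  then have "\<bar>val (itin s y) - y\<bar> \<le> 0"
    using assms by (intro le_zero_of_le_geometric[OF x_bounds]) auto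
  then show ?thesis by simp
qed

text \<open>Both branches increase with slope \<open>B\<close>, so the order of the points survives
  as long as the digits agree. The flags may differ because a point strictly above one with digit 1
  lies strictly above \<open>c\<close>.\<close>

lemma itin_first_difference:
  assumes "y < z" "\<forall>j<k. itin s y j = itin s' z j" "itin s y k"
  shows "itin s' z k"
  using assms
proof (induction k arbitrary: y z)
  case 0
  then show ?case by (auto simp: itin_0 upper_def split: if_splits)
next
  case (Suc k)
  have "upper s y = upper s' z" using Suc.prems(2) itin_0 by auto
  then have "T s y < T s' z" using Suc.prems(1) B_gt_1 by (simp add: T_def)
  moreover have "\<forall>j<k. itin s (T s y) j = itin s' (T s' z) j"
    using Suc.prems(2) itin_Suc by auto
  ultimately show ?case
    using Suc.IH Suc.prems(3) by (simp add: itin_Suc)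
qed

lemma itin_strict_mono:
  assumes "y < z" "0 \<le> y" "z \<le> M"
  shows "less_fun (itin s y) (itin s' z)"
proof -
  have "itin s y \<noteq> itin s' z"
    using val_itin[of y s] val_itin[of z s'] assms by auto
  moreover have "\<not> less_fun (itin s' z) (itin s y)"
    using itin_first_difference[OF assms(1)] by (auto simp: less_fun_def)
  ultimately show ?thesis using less_fun_linear by blast
qed

lemma itin_le_imp_le:
  assumes "lex_le (itin s y) (itin s' z)" "y \<le> M" "0 \<le> z"
  shows "y \<le> z"
proof (rule ccontr)
  assume "\<not> y \<le> z"
  then have "less_fun (itin s' z) (itin s y)"
    using itin_strict_mono[of z y s' s] assms by simp
  then show False using assms(1) not_less_fun_iff by blast
qed

lemma c_range: "0 \<le> c" "c \<le> M"
  using one_le_c c_less_M by auto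

lemma val_\<alpha>: "val \<alpha> = c" and val_\<beta>: "val \<beta> = c"
  unfolding \<alpha>_def \<beta>_def using val_itin[OF c_range] by auto

lemma \<alpha>_0: "\<not> \<alpha> 0" and \<beta>_0: "\<beta> 0"
  by (auto simp: \<alpha>_def \<beta>_def itin_0 upper_def)

lemma shift_\<alpha>: "shift \<alpha> = itin False M"
  using B_c by (simp add: \<alpha>_def shift_itin T_def upper_def)

lemma shift_\<beta>: "shift \<beta> = itin True (M - B)"
proof -
  have "T True c = B * c - B" by (simp add: T_def upper_def algebra_simps)
  then show ?thesis using B_c by (simp add: \<beta>_def shift_itin)
qed

text \<open>Monotonicity leaves \<open>c\<close> as the only point whose itinerary could lie in the
  gap, and there the itinerary is the excluded endpoint \<open>\<alpha>\<close>.\<close>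

lemma itin_False_notin:
  assumes "0 \<le> y" "y \<le> M"
  shows "itin False y \<notin> lex_oc \<alpha> \<beta>"
proof
  assume "itin False y \<in> lex_oc \<alpha> \<beta>"
  then have "less_fun \<alpha> (itin False y)" "lex_le (itin False y) \<beta>"
    by (auto simp: lex_oc_def)
  moreover from this have "c \<le> y" "y \<le> c"
    using itin_le_imp_le[of False c False y] itin_le_imp_le[of False y True c] assms c_range
    by (auto simp: \<alpha>_def \<beta>_def lex_le_def)
  ultimately show False using less_fun_irrefl by (auto simp: \<alpha>_def)
qed

lemma itin_True_notin:
  assumes "0 \<le> y" "y \<le> M"
  shows "itin True y \<notin> lex_co \<alpha> \<beta>"
proof
  assume "itin True y \<in> lex_co \<alpha> \<beta>"
  then have "lex_le \<alpha> (itin True y)" "less_fun (itin True y) \<beta>"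
    by (auto simp: lex_co_def)
  moreover from this have "c \<le> y" "y \<le> c"
    using itin_le_imp_le[of False c True y] itin_le_imp_le[of True y True c] assms c_range
    by (auto simp: \<alpha>_def \<beta>_def lex_le_def)
  ultimately show False using less_fun_irrefl by (auto simp: \<beta>_def)
qed

lemma itin_False_in_Omega_minus: "0 \<le> y \<Longrightarrow> y \<le> M \<Longrightarrow> itin False y \<in> Omega_minus \<alpha> \<beta>"
  unfolding Omega_minus_def mem_Collect_eq funpow_shift_itin
  using T_pow_range itin_False_notin by blast

lemma itin_True_in_Omega_plus: "0 \<le> y \<Longrightarrow> y \<le> M \<Longrightarrow> itin True y \<in> Omega_plus \<alpha> \<beta>"
  unfolding Omega_plus_def mem_Collect_eq funpow_shift_itin
  using T_pow_range itin_True_notin by blast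

lemma admissible_pair: "admissible \<alpha> \<beta>"
proof -
  have "\<alpha> 1" using fun_cong[OF shift_\<alpha>, of 0] c_less_M
    by (simp add: shift_def itin_0 upper_def)
  moreover have "\<not> \<beta> 1" using fun_cong[OF shift_\<beta>, of 0] M_minus_B_less_c
    by (simp add: shift_def itin_0 upper_def)
  moreover have "(shift ^^ n) \<alpha> \<notin> lex_oc \<alpha> \<beta>" "(shift ^^ n) \<beta> \<notin> lex_co \<alpha> \<beta>" for n
    using itin_False_in_Omega_minus[OF c_range] itin_True_in_Omega_plus[OF c_range]
    by (auto simp: \<alpha>_def \<beta>_def Omega_minus_def Omega_plus_def)
  ultimately show ?thesis
    using \<alpha>_0 \<beta>_0 by (auto simp: admissible_def)
qed

section \<open>From lexicographic order back to values\<close>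

text \<open>Where the first digits agree, the comparison passes to the tails and the error shrinks
  by \<open>B\<close>. Where \<open>\<sigma>\<close> starts with 0 but \<open>y > c\<close>, the
  bound \<open>\<alpha>\<close> puts its tail below the itinerary of \<open>M\<close>, and
  \<open>M / B = c < y\<close>. The initial error is the largest value a string can have.\<close>

lemma val_le_of_lex_le_itin:
  assumes "\<forall>n. \<not> \<sigma> n \<longrightarrow> lex_le ((shift ^^ n) \<sigma>) \<alpha>"
    and "lex_le \<sigma> (itin False y)" "0 \<le> y" "y \<le> M"
  shows "val \<sigma> \<le> y"
proof -
  let ?C = "1 / (1 - 1 / B)"
  have "val \<sigma> \<le> y + ?C * (1 / B) ^ n"
    if "\<forall>n. \<not> \<sigma> n \<longrightarrow> lex_le ((shift ^^ n) \<sigma>) \<alpha>"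
      "lex_le \<sigma> (itin False y)" "0 \<le> y" "y \<le> M" for \<sigma> y n
    using that
  proof (induction n arbitrary: \<sigma> y)
    case 0
    then show ?case using strval_le[OF x_bounds, of \<sigma>] by simp
  next
    case (Suc n)
    have tail: "\<forall>n. \<not> shift \<sigma> n \<longrightarrow> lex_le ((shift ^^ n) (shift \<sigma>)) \<alpha>"
      using Suc.prems(1) funpow_shift_Suc by (metis shift_def)
    have step: "val \<sigma> \<le> of_bool (\<sigma> 0) + u / B + ?C * (1 / B) ^ Suc n"
      if "lex_le (shift \<sigma>) (itin False u)" "0 \<le> u" "u \<le> M" for u
    proof -
      have "val (shift \<sigma>) / B \<le> (u + ?C * (1 / B) ^ n) / B"
        using Suc.IH[OF tail that] B_gt_1 by (intro divide_right_mono) auto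
      then show ?thesis using val_unfold[of \<sigma>] by (simp add: add_divide_distrib)
    qed
    show ?case
    proof (cases "\<sigma> 0 = upper False y")
      case True
      then have "lex_le (shift \<sigma>) (itin False (T False y))"
        using Suc.prems(2) lex_le_unfold[of \<sigma>] by (auto simp: shift_itin itin_0)
      from step[OF this T_range[OF Suc.prems(3,4)]] show ?thesis
        using T_expand[of y False] True by simp
    next
      case False
      then have *: "\<not> \<sigma> 0" "upper False y"
        using Suc.prems(2) lex_le_unfold[of \<sigma>] by (auto simp: itin_0)
      then have "lex_le \<sigma> \<alpha>" using spec[OF Suc.prems(1), of 0] by simp
      then have "lex_le (shift \<sigma>) (itin False M)"
        using lex_le_unfold[of \<sigma> \<alpha>] \<alpha>_0 * shift_\<alpha> by auto
      from step[OF this] show ?thesis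
        using * c_range by (auto simp: upper_def c_def[symmetric])
    qed
  qed
  from this[OF assms] have "val \<sigma> - y \<le> ?C * (1 / B) ^ n" for n
    by (simp only: diff_le_eq add.commute)
  then have "val \<sigma> - y \<le> 0"
    by (rule le_zero_of_le_geometric[OF x_bounds])
  then show ?thesis by simp
qed

text \<open>The mirror image: where \<open>\<sigma>\<close> starts with 1 but \<open>y < c\<close>,
  the bound \<open>\<beta>\<close> puts its tail above the itinerary of \<open>M - B\<close>, and
  \<open>1 + (M - B) / B = c > y\<close>.\<close>

lemma val_ge_of_itin_lex_le:
  assumes "\<forall>n. \<sigma> n \<longrightarrow> lex_le \<beta> ((shift ^^ n) \<sigma>)"
    and "lex_le (itin True y) \<sigma>" "0 \<le> y" "y \<le> M"
  shows "y \<le> val \<sigma>"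
proof -
  have "y - M * (1 / B) ^ n \<le> val \<sigma>"
    if "\<forall>n. \<sigma> n \<longrightarrow> lex_le \<beta> ((shift ^^ n) \<sigma>)"
      "lex_le (itin True y) \<sigma>" "0 \<le> y" "y \<le> M" for \<sigma> y n
    using that
  proof (induction n arbitrary: \<sigma> y)
    case 0
    then show ?case using strval_nonneg[OF x_bounds, of \<sigma>] by simp
  next
    case (Suc n)
    have tail: "\<forall>n. shift \<sigma> n \<longrightarrow> lex_le \<beta> ((shift ^^ n) (shift \<sigma>))"
      using Suc.prems(1) funpow_shift_Suc by (metis shift_def)
    have step: "of_bool (\<sigma> 0) + u / B - M * (1 / B) ^ Suc n \<le> val \<sigma>"
      if "lex_le (itin True u) (shift \<sigma>)" "0 \<le> u" "u \<le> M" for u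
    proof -
      have "(u - M * (1 / B) ^ n) / B \<le> val (shift \<sigma>) / B"
        using Suc.IH[OF tail that] B_gt_1 by (intro divide_right_mono) auto
      then show ?thesis using val_unfold[of \<sigma>] by (simp add: diff_divide_distrib)
    qed
    show ?case
    proof (cases "\<sigma> 0 = upper True y")
      case True
      then have "lex_le (itin True (T True y)) (shift \<sigma>)"
        using Suc.prems(2) lex_le_unfold[of _ \<sigma>] by (auto simp: shift_itin itin_0)
      from step[OF this T_range[OF Suc.prems(3,4)]] show ?thesis
        using T_expand[of y True] True by simp
    next
      case False
      then have *: "\<sigma> 0" "\<not> upper True y"
        using Suc.prems(2) lex_le_unfold[of _ \<sigma>] by (auto simp: itin_0)
      then have "lex_le \<beta> \<sigma>" using spec[OF Suc.prems(1), of 0] by simp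
      then have "lex_le (itin True (M - B)) (shift \<sigma>)"
        using lex_le_unfold[of \<beta> \<sigma>] \<beta>_0 * shift_\<beta> by auto
      from step[OF this] show ?thesis
        using * B_le_M B_gt_1 by (auto simp: upper_def c_def diff_divide_distrib)
    qed
  qed
  from this[OF assms] have "y - val \<sigma> \<le> 0"
    by (intro le_zero_of_le_geometric[OF x_bounds]) (simp add: algebra_simps)
  then show ?thesis by simp
qed

lemma val_shift_eq_T_pow:
  assumes "\<forall>j<k. \<sigma> j = itin s y j" "val \<sigma> = y"
  shows "val ((shift ^^ k) \<sigma>) = (T s ^^ k) y"
  using assms
proof (induction k)
  case (Suc k)
  then have "val ((shift ^^ k) \<sigma>) = (T s ^^ k) y" "\<sigma> k = upper s ((T s ^^ k) y)"
    by (auto simp: itin_def)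
  then show ?case
    using val_unfold[of "(shift ^^ k) \<sigma>"] B_gt_1
    by (simp add: funpow_shift T_def[of s "(T s ^^ k) y"] field_simps)
qed simp

text \<open>The criterion by which strings are recognised as itineraries, both in the spaces of the
  pair and in a radix system.\<close>

lemma eq_itin_val:
  assumes "\<And>n. \<sigma> n = upper s (val ((shift ^^ n) \<sigma>))"
  shows "\<sigma> = itin s (val \<sigma>)"
proof -
  have "\<forall>j<k. \<sigma> j = itin s (val \<sigma>) j" for k
  proof (induction k)
    case (Suc k)
    then show ?case
      using val_shift_eq_T_pow[OF Suc.IH] assms[of k] by (auto simp: itin_def less_Suc_eq)
  qed simp
  then show ?thesis by (auto simp: fun_eq_iff)
qed

text \<open>Both endpoints \<open>\<alpha>\<close> and \<open>\<beta>\<close> are allowed as tails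
  here, so the condition covers \<open>Omega_minus\<close> and \<open>Omega_plus\<close>
  alike.\<close>

definition avoids_gap :: "bstring \<Rightarrow> bool" where
  "avoids_gap \<sigma> \<longleftrightarrow> (\<forall>n. (\<not> \<sigma> n \<longrightarrow> lex_le ((shift ^^ n) \<sigma>) \<alpha>) \<and> (\<sigma> n \<longrightarrow> lex_le \<beta> ((shift ^^ n) \<sigma>)))"

lemma avoids_gap_shift:
  assumes "avoids_gap \<sigma>"
  shows "avoids_gap ((shift ^^ n) \<sigma>)"
proof -
  have "(shift ^^ m) ((shift ^^ n) \<sigma>) = (shift ^^ (n + m)) \<sigma>" for m
    by (simp add: fun_eq_iff funpow_shift add.assoc)
  then show ?thesis using assms by (simp add: avoids_gap_def funpow_shift)
qed

lemma val_le_c: "avoids_gap \<sigma> \<Longrightarrow> \<not> \<sigma> 0 \<Longrightarrow> val \<sigma> \<le> c"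
  using val_le_of_lex_le_itin[of \<sigma> c] c_range
  by (auto simp: avoids_gap_def \<alpha>_def dest: spec[of _ 0])

lemma c_le_val: "avoids_gap \<sigma> \<Longrightarrow> \<sigma> 0 \<Longrightarrow> c \<le> val \<sigma>"
  using val_ge_of_itin_lex_le[of \<sigma> c] c_range
  by (auto simp: avoids_gap_def \<beta>_def dest: spec[of _ 0])

text \<open>If the value were \<open>c\<close>, the tails of \<open>\<sigma>\<close> and
  \<open>\<beta>\<close> at their first difference would have equal values. There
  \<open>\<beta>\<close> has digit 0, which means a value below \<open>c\<close>, while the digit 1
  of \<open>\<sigma>\<close> forces a value of at least \<open>c\<close>.\<close>

lemma c_less_val:
  assumes "avoids_gap \<sigma>" "less_fun \<beta> \<sigma>"
  shows "c < val \<sigma>"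
proof -
  have "\<sigma> 0" using assms(2) less_fun_unfold[of \<beta> \<sigma>] \<beta>_0 by auto
  then have "c \<le> val \<sigma>" using c_le_val assms by auto
  moreover have "val \<sigma> \<noteq> c"
  proof
    assume eq: "val \<sigma> = c"
    from assms(2) obtain k where k: "\<not> \<beta> k" "\<sigma> k" "\<forall>j<k. \<sigma> j = \<beta> j"
      by (auto simp: less_fun_def)
    have "val ((shift ^^ k) \<sigma>) = (T True ^^ k) c"
      using val_shift_eq_T_pow[of k \<sigma> True c] k eq by (auto simp: \<beta>_def)
    also have "\<dots> < c" using k(1) by (auto simp: \<beta>_def itin_def upper_def)
    finally show False
      using c_le_val[OF avoids_gap_shift[OF assms(1)], of k] k(2) by (auto simp: funpow_shift)
  qed
  ultimately show ?thesis by simp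
qed

lemma val_less_c:
  assumes "avoids_gap \<sigma>" "less_fun \<sigma> \<alpha>"
  shows "val \<sigma> < c"
proof -
  have "\<not> \<sigma> 0" using assms(2) less_fun_unfold[of \<sigma> \<alpha>] \<alpha>_0 by auto
  then have "val \<sigma> \<le> c" using val_le_c assms by auto
  moreover have "val \<sigma> \<noteq> c"
  proof
    assume eq: "val \<sigma> = c"
    from assms(2) obtain k where k: "\<alpha> k" "\<not> \<sigma> k" "\<forall>j<k. \<sigma> j = \<alpha> j"
      by (auto simp: less_fun_def)
    have "val ((shift ^^ k) \<sigma>) = (T False ^^ k) c"
      using val_shift_eq_T_pow[of k \<sigma> False c] k eq by (auto simp: \<alpha>_def)
    moreover have "c < \<dots>" using k(1) by (auto simp: \<alpha>_def itin_def upper_def)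
    ultimately show False
      using val_le_c[OF avoids_gap_shift[OF assms(1)], of k] k(2) by (auto simp: funpow_shift)
  qed
  ultimately show ?thesis by simp
qed

lemma Omega_minus_tails:
  assumes "\<omega> \<in> Omega_minus \<alpha> \<beta>"
  shows "\<not> \<omega> n \<Longrightarrow> lex_le ((shift ^^ n) \<omega>) \<alpha>" "\<omega> n \<Longrightarrow> less_fun \<beta> ((shift ^^ n) \<omega>)"
proof -
  let ?\<sigma> = "(shift ^^ n) \<omega>"
  have *: "?\<sigma> 0 = \<omega> n" by (simp add: funpow_shift)
  have "lex_le ?\<sigma> \<alpha> \<or> less_fun \<beta> ?\<sigma>"
    using assms not_less_fun_iff by (auto simp: Omega_minus_def lex_oc_def)
  moreover have "lex_le ?\<sigma> \<alpha> \<Longrightarrow> \<not> \<omega> n" using lex_le_unfold[of ?\<sigma> \<alpha>] * \<alpha>_0 by auto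
  moreover have "less_fun \<beta> ?\<sigma> \<Longrightarrow> \<omega> n" using less_fun_unfold[of \<beta> ?\<sigma>] * \<beta>_0 by auto
  ultimately show "\<not> \<omega> n \<Longrightarrow> lex_le ?\<sigma> \<alpha>" "\<omega> n \<Longrightarrow> less_fun \<beta> ?\<sigma>" by auto
qed

lemma Omega_plus_tails:
  assumes "\<omega> \<in> Omega_plus \<alpha> \<beta>"
  shows "\<not> \<omega> n \<Longrightarrow> less_fun ((shift ^^ n) \<omega>) \<alpha>" "\<omega> n \<Longrightarrow> lex_le \<beta> ((shift ^^ n) \<omega>)"
proof -
  let ?\<sigma> = "(shift ^^ n) \<omega>"
  have *: "?\<sigma> 0 = \<omega> n" by (simp add: funpow_shift)
  have "less_fun ?\<sigma> \<alpha> \<or> lex_le \<beta> ?\<sigma>"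
    using assms not_less_fun_iff by (auto simp: Omega_plus_def lex_co_def)
  moreover have "less_fun ?\<sigma> \<alpha> \<Longrightarrow> \<not> \<omega> n" using less_fun_unfold[of ?\<sigma> \<alpha>] * \<alpha>_0 by auto
  moreover have "lex_le \<beta> ?\<sigma> \<Longrightarrow> \<omega> n" using lex_le_unfold[of \<beta> ?\<sigma>] * \<beta>_0 by auto
  ultimately show "\<not> \<omega> n \<Longrightarrow> less_fun ?\<sigma> \<alpha>" "\<omega> n \<Longrightarrow> lex_le \<beta> ?\<sigma>" by auto
qed

lemma avoids_gap_cons0:
  assumes "avoids_gap \<omega>" "lex_le (cons0 \<omega>) \<alpha>"
  shows "avoids_gap (cons0 \<omega>)"
  unfolding avoids_gap_def
proof
  fix n
  show "(\<not> cons0 \<omega> n \<longrightarrow> lex_le ((shift ^^ n) (cons0 \<omega>)) \<alpha>)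
      \<and> (cons0 \<omega> n \<longrightarrow> lex_le \<beta> ((shift ^^ n) (cons0 \<omega>)))"
  proof (cases n)
    case 0
    then show ?thesis using assms by simp
  next
    case (Suc m)
    have "(shift ^^ n) (cons0 \<omega>) = (shift ^^ m) \<omega>"
      unfolding Suc funpow_shift_Suc[symmetric] by simp
    moreover have "cons0 \<omega> n = \<omega> m"
      using Suc by (simp add: cons0_def)
    ultimately show ?thesis using assms by (simp add: avoids_gap_def)
  qed
qed

section \<open>The spaces of the pair as sets of itineraries\<close>

lemma Omega0_minus_eq: "Omega0_minus \<alpha> \<beta> = itin False ` {0..M}"
proof (intro equalityI subsetI)
  fix \<omega> assume "\<omega> \<in> Omega0_minus \<alpha> \<beta>"
  then have \<omega>: "\<omega> \<in> Omega_minus \<alpha> \<beta>" "lex_le (cons0 \<omega>) \<alpha>" by (auto simp: Omega0_minus_def)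
  then have gap: "avoids_gap \<omega>"
    using Omega_minus_tails by (auto simp: avoids_gap_def lex_le_def)
  have "\<omega> n = upper False (val ((shift ^^ n) \<omega>))" for n
    using Omega_minus_tails[OF \<omega>(1), of n] avoids_gap_shift[OF gap, of n]
      c_less_val val_le_c[of "(shift ^^ n) \<omega>"]
    by (fastforce simp: upper_def funpow_shift)
  then have "\<omega> = itin False (val \<omega>)" by (rule eq_itin_val)
  \<comment> \<open>Prefixing a zero divides the value by \<open>B\<close>, so the bound
    \<open>c\<close> for \<open>cons0 \<omega>\<close> is the bound \<open>M\<close> for
    \<open>\<omega>\<close>.\<close>
  moreover have "val \<omega> \<le> M"
    using val_le_c[OF avoids_gap_cons0[OF gap \<omega>(2)]] B_gt_1
    by (simp add: val_cons0 c_def divide_le_cancel)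
  ultimately show "\<omega> \<in> itin False ` {0..M}"
    using strval_nonneg[OF x_bounds, of \<omega>] by auto
next
  fix \<omega> assume "\<omega> \<in> itin False ` {0..M}"
  then obtain y where y: "\<omega> = itin False y" "0 \<le> y" "y \<le> M" by auto
  have "lex_le \<omega> (itin False M)"
    using y itin_strict_mono[of y M] by (cases "y = M") (auto simp: lex_le_def)
  then have "lex_le (cons0 \<omega>) \<alpha>"
    using lex_le_unfold[of "cons0 \<omega>" \<alpha>] \<alpha>_0 by (simp add: shift_\<alpha>)
  then show "\<omega> \<in> Omega0_minus \<alpha> \<beta>"
    using y itin_False_in_Omega_minus by (auto simp: Omega0_minus_def)
qed

lemma Omega0_plus_eq: "Omega0_plus \<alpha> \<beta> = itin True ` {0..<M}"
proof (intro equalityI subsetI)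
  fix \<omega> assume "\<omega> \<in> Omega0_plus \<alpha> \<beta>"
  then have \<omega>: "\<omega> \<in> Omega_plus \<alpha> \<beta>" "less_fun (cons0 \<omega>) \<alpha>" by (auto simp: Omega0_plus_def)
  then have gap: "avoids_gap \<omega>"
    using Omega_plus_tails by (auto simp: avoids_gap_def lex_le_def)
  have "\<omega> n = upper True (val ((shift ^^ n) \<omega>))" for n
    using Omega_plus_tails[OF \<omega>(1), of n] avoids_gap_shift[OF gap, of n]
      val_less_c c_le_val[of "(shift ^^ n) \<omega>"]
    by (fastforce simp: upper_def funpow_shift)
  then have "\<omega> = itin True (val \<omega>)" by (rule eq_itin_val)
  moreover have "val \<omega> < M"
    using val_less_c[OF avoids_gap_cons0[OF gap] \<omega>(2)] \<omega>(2) B_gt_1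
    by (simp add: val_cons0 lex_le_def c_def divide_less_cancel)
  ultimately show "\<omega> \<in> itin True ` {0..<M}"
    using strval_nonneg[OF x_bounds, of \<omega>] by auto
next
  fix \<omega> assume "\<omega> \<in> itin True ` {0..<M}"
  then obtain y where y: "\<omega> = itin True y" "0 \<le> y" "y < M" by auto
  \<comment> \<open>The tail of \<open>\<alpha>\<close> carries the other flag; the strict
    inequality \<open>y < M\<close> makes the comparison across flags possible.\<close>
  have "less_fun \<omega> (itin False M)"
    using y itin_strict_mono[of y M] by auto
  then have "less_fun (cons0 \<omega>) \<alpha>"
    using less_fun_unfold[of "cons0 \<omega>" \<alpha>] \<alpha>_0 by (simp add: shift_\<alpha>)
  then show "\<omega> \<in> Omega0_plus \<alpha> \<beta>"
    using y itin_True_in_Omega_plus by (auto simp: Omega0_plus_def)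
qed

section \<open>Counting words and positive entropy\<close>

lemma card_initial_words_ge:
  "B ^ n / 2 \<le> real (card (initial_words (Omega_pair \<alpha> \<beta>) n))"
proof -
  \<comment> \<open>Points whose itineraries share \<open>n\<close> digits are at most
    \<open>M / B ^ n\<close> apart, so points of a grid with twice this spacing have distinct
    words.\<close>
  define d where "d = 2 * M / B ^ n"
  \<comment> \<open>Rounding up keeps the grid inside \<open>[0, M]\<close>, since every
    \<open>i < N\<close> is still at most \<open>B ^ n / 2\<close>.\<close>
  define N where "N = nat \<lceil>B ^ n / 2\<rceil>"
  define g where "g i = map (itin False (real i * d)) [0..<n]" for i
  have Bn: "0 < B ^ n" using B_gt_1 by simp
  have M: "0 < M" using B_gt_1 B_le_M by simp
  have d: "0 < d" using Bn M by (simp add: d_def)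
  have range: "0 \<le> real i * d" "real i * d \<le> M" if "i < N" for i
  proof -
    have "real i \<le> B ^ n / 2" using that unfolding N_def by linarith
    then have "real i * d \<le> B ^ n / 2 * d" using d by (intro mult_right_mono) auto
    also have "\<dots> = M" using B_gt_1 by (simp add: d_def)
    finally show "real i * d \<le> M" .
  qed (use d in simp)
  have neq: "g i \<noteq> g j" if ij: "i < j" "j < N" for i j
  proof
    assume "g i = g j"
    then have eq: "itin False (real i * d) k = itin False (real j * d) k" if "k < n" for k
      using that by (auto simp: g_def list_eq_iff_nth_eq)
    define y where "y = real i * d"
    define z where "z = real j * d"
    have y: "0 \<le> y" "y \<le> M" and z: "0 \<le> z" "z \<le> M"
      using range ij unfolding y_def z_def by auto
    have tail: "val ((shift ^^ n) (itin False u)) = (T False ^^ n) u"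
      if "0 \<le> u" "u \<le> M" for u
      using val_itin T_pow_range[OF that] by (simp add: funpow_shift_itin)
    have "z - y = val (itin False z) - val (itin False y)" using y z val_itin by simp
    also have "\<dots> = (1 / B) ^ n * ((T False ^^ n) z - (T False ^^ n) y)"
      using eq
      by (subst (1 2) strval_split[OF x_bounds, of _ n])
         (simp add: tail y z y_def[symmetric] z_def[symmetric] right_diff_distrib)
    also have "\<dots> \<le> (1 / B) ^ n * M"
      using T_pow_range[OF y, where s = False and n = n] T_pow_range[OF z, where s = False and n = n] B_gt_1
      by (intro mult_left_mono) auto
    also have "\<dots> < d" using Bn M by (simp add: d_def power_divide field_simps)
    finally have "z - y < d" .
    moreover have "1 * d \<le> (real j - real i) * d"
      using ij d by (intro mult_right_mono) auto
    ultimately show False by (simp add: y_def z_def algebra_simps)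
  qed
  have "inj_on g {..<N}"
    unfolding inj_on_def using neq by (metis lessThan_iff linorder_neqE_nat)
  moreover have "g ` {..<N} \<subseteq> initial_words (Omega_pair \<alpha> \<beta>) n"
    using range itin_False_in_Omega_minus
    by (auto simp: initial_words_def g_def Omega_pair_def)
  moreover have "finite (initial_words (Omega_pair \<alpha> \<beta>) n)"
    by (rule finite_subset[OF _ finite_lists_length_eq[of UNIV n]]) (auto simp: initial_words_def)
  ultimately have "N \<le> card (initial_words (Omega_pair \<alpha> \<beta>) n)"
    using card_inj_on_le[of g "{..<N}"] by simp
  moreover have "B ^ n / 2 \<le> real N" unfolding N_def by linarith
  ultimately show ?thesis by linarith
qed

text \<open>The factor 1/2 in the word count costs only \<open>ln 2 / n\<close>, so the entropy is
  at least \<open>ln B\<close>.\<close>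

lemma not_null_pair: "\<not> null_pair \<alpha> \<beta>"
proof -
  let ?w = "\<lambda>n. real (card (initial_words (Omega_pair \<alpha> \<beta>) n))"
  have lower: "ln B - ln 2 / real n \<le> 1 / real n * ln (?w n)" if "n \<ge> 1" for n
  proof -
    have "real n * ln B - ln 2 = ln (B ^ n / 2)"
      using B_gt_1 by (simp add: ln_div ln_realpow)
    also have "\<dots> \<le> ln (?w n)"
      using card_initial_words_ge[of n] B_gt_1 by (intro ln_mono) auto
    finally have "(real n * ln B - ln 2) / real n \<le> ln (?w n) / real n"
      by (intro divide_right_mono) auto
    then show ?thesis using that by (simp add: diff_divide_distrib)
  qed
  have "(\<lambda>n. ln B - ln 2 / real n) \<longlonglongrightarrow> ln B - 0"
    by (intro tendsto_intros tendsto_divide_0[OF tendsto_const] filterlim_at_top_imp_at_infinity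
        filterlim_real_sequentially)
  then have "limsup (\<lambda>n. ereal (ln B - ln 2 / real n)) = ereal (ln B)"
    by (intro lim_imp_Limsup) auto
  moreover have "limsup (\<lambda>n. ereal (ln B - ln 2 / real n)) \<le> entropy (Omega_pair \<alpha> \<beta>)"
    unfolding entropy_def
    by (intro Limsup_mono eventually_sequentiallyI[of 1]) (use lower in simp)
  moreover have "0 < ln B" using B_gt_1 by simp
  ultimately show ?thesis
    unfolding null_pair_def by (metis ereal_less(2) leD)
qed

subsection \<open>Minimality of the root \<open>1 / B\<close>\<close>

text \<open>If the power series of \<open>\<alpha>\<close> and \<open>\<beta>\<close> agreed at some \<open>t < 1 / B\<close>, then evaluating
  itineraries at \<open>t\<close> would give a function \<open>F\<close> that contracts by \<open>t\<close> on both closed branches,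
  on which lengths expand by \<open>B\<close>. As short intervals are cut at most once in \<open>k\<close> steps, \<open>F\<close> would be
  Hoelder continuous with an exponent larger than 1, hence constant.\<close>

context
  fixes t :: real
  assumes t_pos: "0 < t" and t_less: "t < 1 / B" and root: "strval t \<alpha> = strval t \<beta>"
begin

definition F :: "real \<Rightarrow> real" where
  "F y = strval t (itin False y)"

text \<open>What is kept of an interval that passes \<open>k\<close> steps uncut. Only the images of
  its endpoints are recorded, not the branches taken, since the increments of \<open>F\<close>
  depend on nothing else.\<close>

definition expands :: "nat \<Rightarrow> real \<Rightarrow> real \<Rightarrow> bool" where
  "expands k y z \<longleftrightarrow> (\<exists>y' z'. 0 \<le> y' \<and> y' \<le> z' \<and> z' \<le> M \<and> z' - y' = B ^ k * (z - y) \<and>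
     F z - F y = t ^ k * (F z' - F y'))"

lemma t_bounds: "0 \<le> t" "t < 1"
  using t_pos t_less x_bounds by auto

text \<open>At \<open>c\<close> the two itineraries are \<open>\<beta>\<close> and
  \<open>\<alpha>\<close>, whose values at \<open>t\<close> agree by assumption. Elsewhere both
  flags choose the same branch and the difference is multiplied by \<open>t\<close>. Hence
  \<open>c\<close> may be treated as a point of either branch.\<close>

lemma strval_itin_True:
  assumes "0 \<le> y" "y \<le> M"
  shows "strval t (itin True y) = F y"
proof -
  let ?D = "\<lambda>y. strval t (itin True y) - strval t (itin False y)"
  have C: "0 \<le> 1 / (1 - t)" using t_bounds by simp
  have "0 \<le> y \<Longrightarrow> y \<le> M \<Longrightarrow> \<bar>?D y\<bar> \<le> 1 / (1 - t) * t ^ n" for y n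
  proof (induction n arbitrary: y)
    case 0
    show ?case
      using strval_nonneg[OF t_bounds, of "itin True y"] strval_le[OF t_bounds, of "itin True y"]
        strval_nonneg[OF t_bounds, of "itin False y"] strval_le[OF t_bounds, of "itin False y"]
      by auto
  next
    case (Suc n)
    show ?case
    proof (cases "y = c")
      case True
      then have "?D y = 0" using root by (simp add: \<alpha>_def \<beta>_def)
      then show ?thesis using C t_pos by (simp del: divide_le_0_1_iff)
    next
      case False
      then have u: "upper True y = upper False y" by (auto simp: upper_def)
      then have T: "T True y = T False y" by (simp add: T_def)
      have "?D y = t * ?D (T False y)"
        using strval_unfold[OF t_bounds, of "itin True y"]
          strval_unfold[OF t_bounds, of "itin False y"] u T
        by (simp add: shift_itin itin_0 right_diff_distrib)
      then have "\<bar>?D y\<bar> = t * \<bar>?D (T False y)\<bar>" using t_pos by (simp add: abs_mult)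
      also have "\<dots> \<le> t * (1 / (1 - t) * t ^ n)"
        using Suc.IH[OF T_range[OF Suc.prems]] t_pos by (intro mult_left_mono) auto
      finally show ?thesis by (simp add: mult_ac)
    qed
  qed
  from le_zero_of_le_geometric[OF t_bounds this[OF assms]] show ?thesis by (simp add: F_def)
qed

lemma F_left: "y \<le> c \<Longrightarrow> F y = t * F (B * y)"
  unfolding F_def
  by (subst strval_unfold[OF t_bounds]) (simp add: itin_0 shift_itin upper_def T_def)

lemma F_right:
  assumes "c \<le> y" "y \<le> M"
  shows "F y = 1 + t * F (B * (y - 1))"
proof -
  have y: "0 \<le> y" using assms c_range by simp
  have T: "T True y = B * (y - 1)" using assms by (simp add: T_def upper_def)
  have "F y = strval t (itin True y)" using strval_itin_True[OF y assms(2)] by simp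
  also have "\<dots> = 1 + t * strval t (itin True (T True y))"
    by (subst strval_unfold[OF t_bounds]) (use assms in \<open>simp add: itin_0 shift_itin upper_def\<close>)
  also have "strval t (itin True (T True y)) = F (T True y)"
    using T_range[OF y assms(2)] by (intro strval_itin_True)
  finally show ?thesis using T by simp
qed

lemma left_branch_range: "0 \<le> y \<Longrightarrow> y \<le> c \<Longrightarrow> 0 \<le> B * y \<and> B * y \<le> M"
  using B_gt_1 B_c mult_left_mono[of y c B] by auto

lemma right_branch_range: "c \<le> y \<Longrightarrow> y \<le> M \<Longrightarrow> 0 \<le> B * (y - 1) \<and> B * (y - 1) \<le> M"
  using B_gt_1 right_branch_le one_le_c order_trans[OF mult_left_mono[of "y - 1" "M - 1" B]] by simp

lemma expands_0: "0 \<le> y \<Longrightarrow> y \<le> z \<Longrightarrow> z \<le> M \<Longrightarrow> expands 0 y z"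
  unfolding expands_def by (intro exI[of _ y] exI[of _ z]) simp

lemma expands_left:
  assumes "y \<le> c" "z \<le> c" "expands k (B * y) (B * z)"
  shows "expands (Suc k) y z"
proof -
  from assms(3) obtain y' z' where *: "0 \<le> y'" "y' \<le> z'" "z' \<le> M"
      "z' - y' = B ^ k * (B * z - B * y)" "F (B * z) - F (B * y) = t ^ k * (F z' - F y')"
    unfolding expands_def by blast
  have "F z - F y = t * (F (B * z) - F (B * y))"
    using F_left assms by (simp add: right_diff_distrib)
  then have "F z - F y = t ^ Suc k * (F z' - F y')" using *(5) by simp
  moreover have "z' - y' = B ^ Suc k * (z - y)" using *(4) by (simp add: algebra_simps)
  ultimately show ?thesis unfolding expands_def using * by blast
qed

lemma expands_right:
  assumes "c \<le> y" "y \<le> M" "c \<le> z" "z \<le> M" "expands k (B * (y - 1)) (B * (z - 1))"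
  shows "expands (Suc k) y z"
proof -
  from assms(5) obtain y' z' where *: "0 \<le> y'" "y' \<le> z'" "z' \<le> M"
      "z' - y' = B ^ k * (B * (z - 1) - B * (y - 1))"
      "F (B * (z - 1)) - F (B * (y - 1)) = t ^ k * (F z' - F y')"
    unfolding expands_def by blast
  have "F z - F y = t * (F (B * (z - 1)) - F (B * (y - 1)))"
    using F_right assms by (simp add: right_diff_distrib)
  then have "F z - F y = t ^ Suc k * (F z' - F y')" using *(5) by simp
  moreover have "z' - y' = B ^ Suc k * (z - y)" using *(4) by (simp add: algebra_simps)
  ultimately show ?thesis unfolding expands_def using * by blast
qed

text \<open>A short interval to the right of \<open>u\<close> stays in one closed branch, the right
  one if \<open>u = c\<close>, and its image again starts at the image of \<open>u\<close>.\<close>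

lemma expands_right_neighbourhood:
  assumes "0 \<le> u" "u \<le> M"
  shows "\<exists>\<delta>>0. \<forall>z. u \<le> z \<and> z \<le> M \<and> z - u \<le> \<delta> \<longrightarrow> expands k u z"
  using assms
proof (induction k arbitrary: u)
  case 0
  then show ?case using expands_0 by (intro exI[of _ 1]) auto
next
  case (Suc k)
  show ?case
  proof (cases "u < c")
    case True
    then have "0 \<le> B * u \<and> B * u \<le> M" using left_branch_range[of u] Suc.prems by simp
    from Suc.IH[OF conjunct1[OF this] conjunct2[OF this]] obtain \<delta> where
      \<delta>: "\<delta> > 0" "\<And>z. B * u \<le> z \<Longrightarrow> z \<le> M \<Longrightarrow> z - B * u \<le> \<delta> \<Longrightarrow> expands k (B * u) z" by auto
    have "expands (Suc k) u z" if "u \<le> z" "z \<le> M" "z - u \<le> min (\<delta> / B) (c - u)" for z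
    proof (rule expands_left)
      show "z \<le> c" "u \<le> c" using that True by auto
      have "B * z - B * u \<le> \<delta>" using that B_gt_1 by (simp add: field_simps)
      then show "expands k (B * u) (B * z)"
        using \<delta>(2)[of "B * z"] left_branch_range[of z] \<open>z \<le> c\<close> that(1) Suc.prems B_gt_1 by auto
    qed
    then show ?thesis
      using \<delta>(1) True B_gt_1 by (intro exI[of _ "min (\<delta> / B) (c - u)"]) auto
  next
    case False
    then have "0 \<le> B * (u - 1) \<and> B * (u - 1) \<le> M" using right_branch_range[of u] Suc.prems by simp
    from Suc.IH[OF conjunct1[OF this] conjunct2[OF this]] obtain \<delta> where
      \<delta>: "\<delta> > 0" "\<And>z. B * (u - 1) \<le> z \<Longrightarrow> z \<le> M \<Longrightarrow> z - B * (u - 1) \<le> \<delta> \<Longrightarrow> expands k (B * (u - 1)) z"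
      by auto
    have "expands (Suc k) u z" if "u \<le> z" "z \<le> M" "z - u \<le> \<delta> / B" for z
    proof (rule expands_right)
      have "B * (z - 1) - B * (u - 1) \<le> \<delta>" using that B_gt_1 by (simp add: field_simps)
      then show "expands k (B * (u - 1)) (B * (z - 1))"
        using \<delta>(2)[of "B * (z - 1)"] right_branch_range[of z] that False B_gt_1 by auto
    qed (use that False Suc.prems in auto)
    then show ?thesis
      using \<delta>(1) B_gt_1 by (intro exI[of _ "\<delta> / B"]) auto
  qed
qed

text \<open>As before with \<open>u\<close> as right endpoint; now \<open>u = c\<close> is assigned
  to the left branch.\<close>

lemma expands_left_neighbourhood:
  assumes "0 \<le> u" "u \<le> M"
  shows "\<exists>\<delta>>0. \<forall>y. 0 \<le> y \<and> y \<le> u \<and> u - y \<le> \<delta> \<longrightarrow> expands k y u"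
  using assms
proof (induction k arbitrary: u)
  case 0
  then show ?case using expands_0 by (intro exI[of _ 1]) auto
next
  case (Suc k)
  show ?case
  proof (cases "u \<le> c")
    case True
    then have "0 \<le> B * u \<and> B * u \<le> M" using left_branch_range[of u] Suc.prems by simp
    from Suc.IH[OF conjunct1[OF this] conjunct2[OF this]] obtain \<delta> where
      \<delta>: "\<delta> > 0" "\<And>y. 0 \<le> y \<Longrightarrow> y \<le> B * u \<Longrightarrow> B * u - y \<le> \<delta> \<Longrightarrow> expands k y (B * u)" by auto
    have "expands (Suc k) y u" if "0 \<le> y" "y \<le> u" "u - y \<le> \<delta> / B" for y
    proof (rule expands_left)
      have "B * u - B * y \<le> \<delta>" using that B_gt_1 by (simp add: field_simps)
      then show "expands k (B * y) (B * u)"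
        using \<delta>(2)[of "B * y"] left_branch_range[of y] True that B_gt_1 by auto
    qed (use that True in auto)
    then show ?thesis
      using \<delta>(1) B_gt_1 by (intro exI[of _ "\<delta> / B"]) auto
  next
    case False
    then have "0 \<le> B * (u - 1) \<and> B * (u - 1) \<le> M" using right_branch_range[of u] Suc.prems by simp
    from Suc.IH[OF conjunct1[OF this] conjunct2[OF this]] obtain \<delta> where
      \<delta>: "\<delta> > 0" "\<And>y. 0 \<le> y \<Longrightarrow> y \<le> B * (u - 1) \<Longrightarrow> B * (u - 1) - y \<le> \<delta> \<Longrightarrow> expands k y (B * (u - 1))"
      by auto
    have "expands (Suc k) y u" if "0 \<le> y" "y \<le> u" "u - y \<le> min (\<delta> / B) (u - c)" for y
    proof (rule expands_right)
      show "c \<le> y" using that by simp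
      have "B * (u - 1) - B * (y - 1) \<le> \<delta>" using that B_gt_1 by (simp add: field_simps)
      then show "expands k (B * (y - 1)) (B * (u - 1))"
        using \<delta>(2)[of "B * (y - 1)"] right_branch_range[of y] \<open>c \<le> y\<close> that(1,2) Suc.prems B_gt_1
        by auto
    qed (use that False Suc.prems in auto)
    then show ?thesis
      using \<delta>(1) False B_gt_1 by (intro exI[of _ "min (\<delta> / B) (u - c)"]) auto
  qed
qed

text \<open>Until the interval straddles \<open>c\<close>, a cut point is pulled back along its
  branch. When it does, it is cut at \<open>c\<close>: the left image ends at \<open>M\<close> and
  the right image starts at \<open>B * (c - 1)\<close>. The one-sided neighbourhoods of these two
  fixed points make a second cut unnecessary.\<close>

lemma expands_split:
  "\<exists>\<delta>>0. \<forall>y z. 0 \<le> y \<and> y \<le> z \<and> z \<le> M \<and> z - y \<le> \<delta> \<longrightarrow>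
     (\<exists>p. y \<le> p \<and> p \<le> z \<and> expands k y p \<and> expands k p z)"
proof (induction k)
  case 0
  have "y \<le> y \<and> y \<le> z \<and> expands 0 y y \<and> expands 0 y z" if "0 \<le> y" "y \<le> z" "z \<le> M" for y z
    using that expands_0 by simp
  then show ?case using zero_less_one by blast
next
  case (Suc k)
  then obtain \<delta> where \<delta>: "\<delta> > 0" "\<And>y z. 0 \<le> y \<Longrightarrow> y \<le> z \<Longrightarrow> z \<le> M \<Longrightarrow> z - y \<le> \<delta> \<Longrightarrow>
      \<exists>p. y \<le> p \<and> p \<le> z \<and> expands k y p \<and> expands k p z" by blast
  obtain \<delta>1 where \<delta>1: "\<delta>1 > 0" "\<And>y. 0 \<le> y \<Longrightarrow> y \<le> M \<Longrightarrow> M - y \<le> \<delta>1 \<Longrightarrow> expands k y M"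
    using expands_left_neighbourhood[of M k] B_gt_1 B_le_M by auto
  have m: "0 \<le> B * (c - 1)" "B * (c - 1) \<le> M"
    using right_branch_range[of c] c_range by auto
  obtain \<delta>2 where \<delta>2: "\<delta>2 > 0" "\<And>z. B * (c - 1) \<le> z \<Longrightarrow> z \<le> M \<Longrightarrow> z - B * (c - 1) \<le> \<delta>2
      \<Longrightarrow> expands k (B * (c - 1)) z"
    using expands_right_neighbourhood[OF m, of k] by auto
  \<comment> \<open>The three bounds apply after one step, which stretches the length by
    \<open>B\<close>.\<close>
  let ?\<epsilon> = "min \<delta> (min \<delta>1 \<delta>2) / B"
  have "\<exists>p. y \<le> p \<and> p \<le> z \<and> expands (Suc k) y p \<and> expands (Suc k) p z"
    if yz: "0 \<le> y" "y \<le> z" "z \<le> M" "z - y \<le> ?\<epsilon>" for y z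
  proof -
    have "B * (z - y) \<le> min \<delta> (min \<delta>1 \<delta>2)"
      using yz(4) B_gt_1 by (simp only: pos_le_divide_eq mult.commute)
    then have len: "B * z - B * y \<le> \<delta>" "B * z - B * y \<le> \<delta>1" "B * z - B * y \<le> \<delta>2"
      by (simp_all add: right_diff_distrib)
    consider "z \<le> c" | "c \<le> y" | "y < c" "c < z" by linarith
    then show ?thesis
    proof cases
      case 1
      have "B * y \<le> B * z" using yz B_gt_1 by simp
      then obtain q where q: "B * y \<le> q" "q \<le> B * z" "expands k (B * y) q" "expands k q (B * z)"
        using \<delta>(2)[of "B * y" "B * z"] left_branch_range[of y] left_branch_range[of z] 1 yz len
        by auto
      define p where "p = q / B"
      have p: "q = B * p" using B_gt_1 by (simp add: p_def)
      then have "y \<le> p" "p \<le> z" using q(1,2) B_gt_1 by auto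
      then show ?thesis
        using q(3,4) 1 expands_left unfolding p by (intro exI[of _ p]) auto
    next
      case 2
      have "B * (y - 1) \<le> B * (z - 1)" using yz B_gt_1 by simp
      moreover have "B * (z - 1) - B * (y - 1) \<le> \<delta>" using len by (simp add: algebra_simps)
      ultimately obtain q where q: "B * (y - 1) \<le> q" "q \<le> B * (z - 1)"
          "expands k (B * (y - 1)) q" "expands k q (B * (z - 1))"
        using \<delta>(2)[of "B * (y - 1)" "B * (z - 1)"] right_branch_range[of y] right_branch_range[of z]
          2 yz by auto
      define p where "p = q / B + 1"
      have p: "q = B * (p - 1)" using B_gt_1 by (simp add: p_def)
      then have "y \<le> p" "p \<le> z" using q(1,2) B_gt_1 by auto
      then show ?thesis
        using q(3,4) 2 yz expands_right unfolding p by (intro exI[of _ p]) auto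
    next
      case 3
      have "B * c \<le> B * z" "B * y \<le> B * c" using 3 B_gt_1 by auto
      moreover have "B * (z - 1) - B * (c - 1) = B * z - B * c" by (simp add: algebra_simps)
      ultimately have "expands k (B * y) (B * c)" "expands k (B * (c - 1)) (B * (z - 1))"
        using \<delta>1(2)[of "B * y"] \<delta>2(2)[of "B * (z - 1)"] left_branch_range[of y]
          right_branch_range[of z] 3 yz len B_c by auto
      then show ?thesis
        using 3 yz c_range expands_left expands_right by (intro exI[of _ c]) auto
    qed
  qed
  moreover have "0 < ?\<epsilon>" using \<delta>(1) \<delta>1(1) \<delta>2(1) B_gt_1 by simp
  ultimately show ?case by blast
qed

lemma no_smaller_root: False
proof -
  have tB: "0 < t * B" "t * B < 1" using t_pos t_less B_gt_1 by (auto simp: field_simps)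
  \<comment> \<open>A block of \<open>k\<close> steps costs a factor 2 for its cut; this choice
    makes \<open>2 * (t * B) ^ k < 1\<close>.\<close>
  obtain k where k: "(t * B) ^ k < 1 / 2"
    using real_arch_pow_inv[of "1 / 2" "t * B"] tB by auto
  obtain \<delta> where \<delta>: "\<delta> > 0" "\<And>y z. 0 \<le> y \<Longrightarrow> y \<le> z \<Longrightarrow> z \<le> M \<Longrightarrow> z - y \<le> \<delta> \<Longrightarrow>
      \<exists>p. y \<le> p \<and> p \<le> z \<and> expands k y p \<and> expands k p z"
    using expands_split[of k] by blast
  define C where "C = 1 / (1 - t)"
  have C: "0 \<le> C" using t_bounds by (simp add: C_def)
  have Bk: "1 \<le> B ^ k" using B_gt_1 by simp
  \<comment> \<open>Each block stretches both pieces by \<open>B ^ k\<close> and shrinks increments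
    of \<open>F\<close> by \<open>t ^ k\<close>; the 2 counts the pieces.\<close>
  have holder: "\<bar>F z - F y\<bar> \<le> C * (2 * t ^ k) ^ j"
    if "0 \<le> y" "y \<le> z" "z \<le> M" "z - y \<le> \<delta> / (B ^ k) ^ j" for y z j
    using that
  proof (induction j arbitrary: y z)
    case 0
    show ?case
      using strval_nonneg[OF t_bounds, of "itin False y"] strval_le[OF t_bounds, of "itin False y"]
        strval_nonneg[OF t_bounds, of "itin False z"] strval_le[OF t_bounds, of "itin False z"]
      unfolding F_def C_def by auto
  next
    case (Suc j)
    have "\<delta> / (B ^ k) ^ Suc j \<le> \<delta> / 1"
      using \<delta>(1) B_gt_1 by (intro divide_left_mono one_le_power) auto
    then obtain p where p: "y \<le> p" "p \<le> z" "expands k y p" "expands k p z"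
      using \<delta>(2)[of y z] Suc.prems by force
    have step: "\<bar>F w - F u\<bar> \<le> t ^ k * (C * (2 * t ^ k) ^ j)"
      if "expands k u w" "w - u \<le> \<delta> / (B ^ k) ^ Suc j" for u w
    proof -
      from that(1) obtain u' w' where *: "0 \<le> u'" "u' \<le> w'" "w' \<le> M" "w' - u' = B ^ k * (w - u)"
          "F w - F u = t ^ k * (F w' - F u')"
        unfolding expands_def by blast
      have "w' - u' \<le> B ^ k * (\<delta> / (B ^ k) ^ Suc j)"
        unfolding *(4) using that(2) Bk by (intro mult_left_mono) auto
      also have "\<dots> = \<delta> / (B ^ k) ^ j" using B_gt_1 by simp
      finally have "\<bar>F w' - F u'\<bar> \<le> C * (2 * t ^ k) ^ j" using Suc.IH * by blast
      then show ?thesis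
        unfolding *(5) abs_mult using t_pos by (simp add: mult_left_mono)
    qed
    have "\<bar>F p - F y\<bar> \<le> t ^ k * (C * (2 * t ^ k) ^ j)"
      "\<bar>F z - F p\<bar> \<le> t ^ k * (C * (2 * t ^ k) ^ j)"
      using step[OF p(3)] step[OF p(4)] p(1,2) Suc.prems(4) by auto
    then have "\<bar>F z - F y\<bar> \<le> 2 * (t ^ k * (C * (2 * t ^ k) ^ j))" by linarith
    then show ?case by (simp add: mult_ac)
  qed
  have "\<bar>F c - F 0\<bar> \<le> ((M / \<delta> + 1) * C) * (2 * (t * B) ^ k) ^ j" for j
  proof -
    define A where "A = (B ^ k) ^ j"
    define E where "E = C * (2 * t ^ k) ^ j"
    \<comment> \<open>Enough equal steps to walk from 0 to \<open>c\<close> with each one no longer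
      than \<open>\<delta> / A\<close>, the length to which the bound for \<open>j\<close> blocks
      applies.\<close>
    define n where "n = nat \<lceil>M * A / \<delta>\<rceil>"
    define h where "h = c / real n"
    have A: "1 \<le> A" using Bk by (simp add: A_def one_le_power)
    have E: "0 \<le> E" using C t_pos by (simp add: E_def)
    have M: "0 < M" using B_gt_1 B_le_M by simp
    have pos: "0 < M * A / \<delta>" using M A \<delta>(1) by simp
    have n: "M * A / \<delta> \<le> real n" "real n \<le> M * A / \<delta> + 1" "0 < real n"
      using pos unfolding n_def by linarith+
    have h: "0 \<le> h" using c_range by (simp add: h_def)
    have nh: "real n * h = c" using n by (simp add: h_def)
    have "c \<le> real n * (\<delta> / A)"
    proof -
      have "c \<le> M" by (rule c_range)
      also have "\<dots> = M * A / \<delta> * (\<delta> / A)" using A \<delta>(1) by simp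
      also have "\<dots> \<le> real n * (\<delta> / A)" using n A \<delta>(1) by (intro mult_right_mono) auto
      finally show ?thesis .
    qed
    then have h_le: "h \<le> \<delta> / A" using n(3) by (simp add: h_def divide_le_eq mult.commute)
    have "\<bar>F (real i * h) - F 0\<bar> \<le> real i * E" if "i \<le> n" for i
      using that
    proof (induction i)
      case (Suc i)
      have "real (Suc i) * h \<le> real n * h" using Suc.prems h by (intro mult_right_mono) auto
      then have "\<bar>F (real (Suc i) * h) - F (real i * h)\<bar> \<le> E"
        unfolding E_def using h_le h nh c_range
        by (intro holder) (auto simp: A_def algebra_simps)
      then show ?case using Suc by (simp add: algebra_simps)
    qed simp
    from this[of n] have "\<bar>F c - F 0\<bar> \<le> real n * E" using nh by simp
    \<comment> \<open>Since \<open>A \<ge> 1\<close>, it absorbs the 1 from rounding up and can be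
      factored out.\<close>
    also have "\<dots> \<le> (M * A / \<delta> + A) * E" using n A E by (intro mult_right_mono) auto
    also have "\<dots> = ((M / \<delta> + 1) * C) * (A * (2 * t ^ k) ^ j)"
      by (simp add: E_def algebra_simps add_divide_distrib)
    also have "A * (2 * t ^ k) ^ j = (2 * (t * B) ^ k) ^ j"
      by (simp add: A_def power_mult_distrib mult_ac)
    finally show ?thesis .
  qed
  then have "\<bar>F c - F 0\<bar> \<le> 0"
    using tB k by (intro le_zero_of_le_geometric[of "2 * (t * B) ^ k"]) auto
  \<comment> \<open>The contradiction: 0 is fixed by the left branch, whereas at \<open>c\<close>
    the right branch contributes a leading digit 1.\<close>
  moreover have "F 0 = 0"
  proof -
    have "(1 - t) * F 0 = 0" using F_left[of 0] c_range by (simp add: algebra_simps)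
    then show ?thesis using t_bounds by simp
  qed
  moreover have "1 \<le> F c"
    using F_right[of c] c_range t_pos strval_nonneg[OF t_bounds] by (simp add: F_def)
  ultimately show False by simp
qed

end

lemma pair_base_eq: "pair_base \<alpha> \<beta> = B"
proof -
  have "(LEAST x. x \<in> {1/2..<1} \<and> strval x \<alpha> = strval x \<beta>) = 1 / B"
  proof (rule Least_equality)
    show "1 / B \<in> {1/2..<1} \<and> strval (1 / B) \<alpha> = strval (1 / B) \<beta>"
      using B_le_2 B_gt_1 val_\<alpha> val_\<beta> by (simp add: field_simps)
  next
    fix r :: real assume r: "r \<in> {1/2..<1} \<and> strval r \<alpha> = strval r \<beta>"
    show "1 / B \<le> r"
    proof (rule ccontr)
      assume "\<not> 1 / B \<le> r"
      then show False using no_smaller_root[of r] r by auto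
    qed
  qed
  then show ?thesis by (simp add: pair_base_def strval_def)
qed

end

section \<open>Radix systems\<close>

text \<open>The strings of a radix system: inserting a point scales values by powers of \<open>B\<close>.\<close>

locale radix_strings = radix_base B for B :: real +
  fixes H :: "bstring set"
  assumes shift_mem: "\<omega> \<in> H \<Longrightarrow> shift \<omega> \<in> H"
    and cons0_mem: "\<omega> \<in> H \<Longrightarrow> cons0 \<omega> \<in> H"
    and strict: "\<omega> \<in> H \<Longrightarrow> \<sigma> \<in> H \<Longrightarrow> less_fun \<omega> \<sigma> \<Longrightarrow> val \<omega> < val \<sigma>"
    and onto: "0 \<le> y \<Longrightarrow> \<exists>N. \<exists>\<omega>\<in>H. y = B ^ N * val \<omega>"
begin

text \<open>Whether this supremum is attained decides which branch owns the critical point.\<close>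

definition M :: real where "M = Sup (val ` H)"

lemma val_inj: "\<omega> \<in> H \<Longrightarrow> \<sigma> \<in> H \<Longrightarrow> val \<omega> = val \<sigma> \<Longrightarrow> \<omega> = \<sigma>"
  using less_fun_linear[of \<omega> \<sigma>] strict[of \<omega> \<sigma>] strict[of \<sigma> \<omega>] by auto

lemma funpow_shift_mem: "\<omega> \<in> H \<Longrightarrow> (shift ^^ n) \<omega> \<in> H"
  by (induction n) (auto intro: shift_mem)

text \<open>Some string has value \<open>y / B ^ N\<close>, and the power is removed by shifting
  away leading zeros. A leading 1 would put the string above \<open>cons0 \<rho>\<close>, making
  \<open>y\<close> exceed \<open>val \<rho>\<close>.\<close>

lemma mem_values_of_le:
  assumes "\<rho> \<in> H" "0 \<le> y" "y \<le> val \<rho>"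
  shows "\<exists>\<omega>\<in>H. val \<omega> = y"
proof -
  have "\<exists>\<omega>'\<in>H. val \<omega>' = B ^ N * val \<omega>" if "\<omega> \<in> H" "B ^ N * val \<omega> \<le> val \<rho>" for N \<omega>
    using that
  proof (induction N arbitrary: \<omega>)
    case (Suc N)
    have "\<not> \<omega> 0"
    proof
      assume "\<omega> 0"
      then have "less_fun (cons0 \<rho>) \<omega>" using less_fun_unfold[of "cons0 \<rho>" \<omega>] by simp
      then have "val \<rho> / B < val \<omega>"
        using strict cons0_mem[OF assms(1)] Suc.prems(1) by (simp add: val_cons0[symmetric])
      then have "val \<rho> < B ^ 1 * val \<omega>" using B_gt_1 by (simp add: field_simps)
      also have "\<dots> \<le> B ^ Suc N * val \<omega>"
        using B_gt_1 strval_nonneg[OF x_bounds] by (intro mult_right_mono power_increasing) auto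
      finally show False using Suc.prems(2) by simp
    qed
    then have "B * val \<omega> = val (shift \<omega>)" using val_unfold[of \<omega>] B_gt_1 by simp
    then have *: "B ^ Suc N * val \<omega> = B ^ N * val (shift \<omega>)" by simp
    show ?case using Suc.IH[OF shift_mem[OF Suc.prems(1)]] Suc.prems(2) unfolding * by blast
  qed auto
  then show ?thesis using onto[OF assms(2)] assms(3) by blast
qed

lemma bdd: "bdd_above (val ` H)"
  using strval_le[OF x_bounds] by (auto intro!: bdd_aboveI[of _ "1 / (1 - 1 / B)"])

lemma val_le_M: "\<omega> \<in> H \<Longrightarrow> val \<omega> \<le> M"
  unfolding M_def using bdd by (intro cSup_upper) auto

lemma mem_values_of_less:
  assumes "0 \<le> y" "y < M"
  shows "\<exists>\<omega>\<in>H. val \<omega> = y"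
proof -
  have "val ` H \<noteq> {}" using onto[of 0] by auto
  then obtain \<rho> where "\<rho> \<in> H" "y < val \<rho>"
    using assms(2) less_cSup_iff[OF _ bdd] by (auto simp: M_def)
  then show ?thesis using mem_values_of_le assms by auto
qed

lemma M_pos: "0 < M"
proof -
  obtain N \<omega> where *: "\<omega> \<in> H" "1 = B ^ N * val \<omega>" using onto[of 1] by auto
  then have "val \<omega> \<noteq> 0" by auto
  then have "0 < val \<omega>" using strval_nonneg[OF x_bounds, of \<omega>] by auto
  then show ?thesis using val_le_M[OF *(1)] by simp
qed

lemma val_eq_of_not_digit: "\<not> \<omega> 0 \<Longrightarrow> val \<omega> = val (shift \<omega>) / B"
  by (subst val_unfold) simp

lemma val_neq_of_digit:
  assumes "\<omega> \<in> H" "\<omega> 0" "\<sigma> \<in> H"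
  shows "val \<omega> \<noteq> val \<sigma> / B"
proof
  assume "val \<omega> = val \<sigma> / B"
  then have "\<omega> = cons0 \<sigma>" using val_inj assms cons0_mem val_cons0 by metis
  then show False using assms(2) by simp
qed

lemma le_val_of_digit:
  assumes "\<omega> \<in> H" "\<omega> 0"
  shows "M / B \<le> val \<omega>"
proof (rule ccontr)
  assume "\<not> M / B \<le> val \<omega>"
  then have "B * val \<omega> < M" using B_gt_1 by (simp add: field_simps)
  then obtain \<sigma> where \<sigma>: "\<sigma> \<in> H" "val \<sigma> = B * val \<omega>"
    using mem_values_of_less[of "B * val \<omega>"] strval_nonneg[OF x_bounds, of \<omega>] B_gt_1 by auto
  then have "val \<omega> = val \<sigma> / B" using B_gt_1 by simp
  then show False using val_neq_of_digit assms \<sigma> by blast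
qed

lemma val_le_of_not_digit: "\<omega> \<in> H \<Longrightarrow> \<not> \<omega> 0 \<Longrightarrow> val \<omega> \<le> M / B"
  using val_le_M[OF shift_mem, of \<omega>] B_gt_1 by (simp add: val_eq_of_not_digit divide_right_mono)

text \<open>Such a value belongs to a string with first digit 1, whose tail has a value in
  \<open>[0, M]\<close>. This is the source of both inequalities required of the critical
  map.\<close>

lemma string_above:
  assumes "M / B < y" "y < M"
  shows "1 \<le> y" "B * (y - 1) \<le> M"
proof -
  have "0 \<le> M / B" using M_pos B_gt_1 by simp
  then obtain \<omega> where \<omega>: "\<omega> \<in> H" "val \<omega> = y"
    using mem_values_of_less[of y] assms by auto
  then have "\<omega> 0" using val_le_of_not_digit assms(1) by force
  then have y: "y = 1 + val (shift \<omega>) / B" using val_unfold[of \<omega>] \<omega> by simp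
  then show "1 \<le> y" using strval_nonneg[OF x_bounds, of "shift \<omega>"] B_gt_1 by simp
  show "B * (y - 1) \<le> M" using y val_le_M[OF shift_mem[OF \<omega>(1)]] B_gt_1 by simp
qed

lemma M_div_B_less: "M / B < M"
  using M_pos B_gt_1 by (simp add: field_simps)

sublocale critical_map B M
proof
  show "B \<le> M"
  proof (rule ccontr)
    assume "\<not> B \<le> M"
    \<comment> \<open>Otherwise some value below 1 would need a first digit 1, which alone
      contributes 1.\<close>
    then have "M / B < min 1 M" using M_div_B_less B_gt_1 by (simp add: field_simps)
    then obtain y where "M / B < y" "y < min 1 M" using dense by blast
    then show False using string_above(1)[of y] by simp
  qed
  show "B * (M - 1) \<le> M"
  proof (rule ccontr)
    assume "\<not> B * (M - 1) \<le> M"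
    \<comment> \<open>Otherwise removing the leading 1 from a value close to \<open>M\<close> would
      leave a tail of value above \<open>M\<close>.\<close>
    then have "M / B + 1 < M" using B_gt_1 by (simp add: field_simps)
    then obtain y where y: "M / B + 1 < y" "y < M" using dense by blast
    then have "M < B * (y - 1)" using B_gt_1 by (simp add: field_simps)
    then show False using string_above(2)[of y] y by simp
  qed
qed

text \<open>If \<open>\<rho>\<close> has value \<open>M\<close>, the unique string of value
  \<open>c\<close> is \<open>cons0 \<rho>\<close>, so \<open>c\<close> belongs to the left
  branch.\<close>

lemma strings_eq_itin_False:
  assumes "M \<in> val ` H"
  shows "H = itin False ` {0..M}"
proof -
  obtain \<rho> where \<rho>: "\<rho> \<in> H" "M = val \<rho>" using assms by auto
  have "\<omega> 0 = upper False (val \<omega>)" if "\<omega> \<in> H" for \<omega>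
  proof -
    have "val \<omega> \<noteq> M / B" if "\<omega> 0" unfolding \<rho>(2) by (rule val_neq_of_digit[OF \<open>\<omega> \<in> H\<close> that \<rho>(1)])
    then show ?thesis
      using le_val_of_digit[OF that] val_le_of_not_digit[OF that] by (force simp: upper_def c_def)
  qed
  then have "\<omega> = itin False (val \<omega>)" if "\<omega> \<in> H" for \<omega>
    using funpow_shift_mem[OF that] by (intro eq_itin_val) (metis add_0_right funpow_shift)
  moreover have "\<exists>\<omega>\<in>H. val \<omega> = y" if "0 \<le> y" "y \<le> M" for y
    using mem_values_of_less[of y] assms that by (cases "y = M") auto
  ultimately show ?thesis
    using val_le_M strval_nonneg[OF x_bounds]
    by (auto intro!: image_eqI) (metis)
qed

text \<open>If \<open>M\<close> is not attained, a string starting with 0 has a tail of value below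
  \<open>M\<close>, hence a value below \<open>c\<close>, so \<open>c\<close> belongs to the right
  branch.\<close>

lemma strings_eq_itin_True:
  assumes "M \<notin> val ` H"
  shows "H = itin True ` {0..<M}"
proof -
  have less: "val \<omega> < M" if "\<omega> \<in> H" for \<omega>
    using val_le_M[OF that] assms that by (metis image_eqI order_le_less)
  have "\<omega> 0 = upper True (val \<omega>)" if "\<omega> \<in> H" for \<omega>
  proof -
    have "val \<omega> < M / B" if "\<not> \<omega> 0"
      using less[OF shift_mem[OF \<open>\<omega> \<in> H\<close>]] B_gt_1
      by (simp add: val_eq_of_not_digit[of \<omega>, OF that] divide_strict_right_mono)
    then show ?thesis
      using le_val_of_digit[OF that] by (force simp: upper_def c_def)
  qed
  then have "\<omega> = itin True (val \<omega>)" if "\<omega> \<in> H" for \<omega>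
    using funpow_shift_mem[OF that] by (intro eq_itin_val) (metis add_0_right funpow_shift)
  then show ?thesis
    using mem_values_of_less less strval_nonneg[OF x_bounds]
    by (auto intro!: image_eqI) (metis)
qed

end

text \<open>Shift invariance with \<open>n = 0\<close> lets the point be placed anywhere, and with
  \<open>n = 1\<close> it gives closure under \<open>shift\<close>. Closure under
  \<open>cons0\<close> holds because initial zeros do not change a decimal.\<close>

lemma radix_strings_hat:
  assumes "binary_radix_system \<Gamma> \<pi> B"
  shows "radix_strings B (hat \<Gamma>)"
proof
  have dec: "\<Gamma> \<subseteq> dot UNIV" and inv: "dot ((shift ^^ n) ` hat \<Gamma>) = \<Gamma>"
    and bij: "bij_betw \<pi> \<Gamma> {0..}" and mono: "monotone_on \<Gamma> dec_less (<) \<pi>"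
    and vals: "\<And>d. d \<in> \<Gamma> \<Longrightarrow> \<pi> d = dec_value B d" for n
    using assms by (auto simp: binary_radix_system_def shift_invariant_def)
  show B: "1 < B" using assms by (simp add: binary_radix_system_def)
  have point: "point_at N \<omega> \<in> \<Gamma>" if "\<omega> \<in> hat \<Gamma>" for N \<omega>
  proof -
    have "point_at N \<omega> \<in> dot ((shift ^^ 0) ` hat \<Gamma>)" using that by (auto simp: dot_def)
    then show ?thesis unfolding inv .
  qed
  have val: "\<pi> (point_at N \<omega>) = B ^ N * strval (1 / B) \<omega>" if "\<omega> \<in> hat \<Gamma>" for N \<omega>
    using vals[OF point[OF that]] dec_value_eq_strval[OF B] by simp
  show "shift \<omega> \<in> hat \<Gamma>" if "\<omega> \<in> hat \<Gamma>" for \<omega>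
  proof -
    have "point_at 0 (shift \<omega>) \<in> dot ((shift ^^ 1) ` hat \<Gamma>)" using that by (auto simp: dot_def)
    then have "point_at 0 (shift \<omega>) \<in> \<Gamma>" unfolding inv .
    then show ?thesis unfolding hat_def by blast
  qed
  show "cons0 \<omega> \<in> hat \<Gamma>" if "\<omega> \<in> hat \<Gamma>" for \<omega>
    using point[OF that, of 0] point_at_eq_iff[of 0 \<omega> 1 "cons0 \<omega>"] unfolding hat_def by auto
  show "strval (1 / B) \<omega> < strval (1 / B) \<sigma>"
    if "\<omega> \<in> hat \<Gamma>" "\<sigma> \<in> hat \<Gamma>" "less_fun \<omega> \<sigma>" for \<omega> \<sigma>
  proof -
    have "point_at 0 \<omega> \<noteq> point_at 0 \<sigma>"
      using that(3) less_fun_irrefl point_at_eq_iff[of 0 \<omega> 0 \<sigma>] by auto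
    then have "dec_less (point_at 0 \<omega>) (point_at 0 \<sigma>)"
      using that(3) unfolding dec_less_def by blast
    then have "\<pi> (point_at 0 \<omega>) < \<pi> (point_at 0 \<sigma>)"
      using mono point that by (auto simp: monotone_on_def)
    then show ?thesis using val that by simp
  qed
  show "\<exists>N. \<exists>\<omega>\<in>hat \<Gamma>. y = B ^ N * strval (1 / B) \<omega>" if "0 \<le> y" for y
  proof -
    have "y \<in> \<pi> ` \<Gamma>" using bij that by (simp add: bij_betw_def)
    then obtain d where d: "d \<in> \<Gamma>" "\<pi> d = y" by auto
    then obtain N \<omega> where N: "d = point_at N \<omega>" using dec by (auto simp: dot_def)
    then have "\<omega> \<in> hat \<Gamma>" using d(1) by (auto simp: hat_def)
    then show ?thesis using val d(2) N by blast
  qed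
qed

theorem mainTheorem5:
  fixes \<Gamma> :: "decimal set" and \<pi> :: "decimal \<Rightarrow> real" and B :: real
  assumes "binary_radix_system \<Gamma> \<pi> B"
  shows "\<exists>\<alpha> \<beta>. admissible \<alpha> \<beta> \<and> \<not> null_pair \<alpha> \<beta> \<and>
           (R_minus \<alpha> \<beta> = (\<Gamma>, \<pi>, B) \<or> R_plus \<alpha> \<beta> = (\<Gamma>, \<pi>, B))"
proof -
  interpret radix_strings B "hat \<Gamma>" by (rule radix_strings_hat[OF assms])
  have "hat \<Gamma> = Omega0_minus \<alpha> \<beta> \<or> hat \<Gamma> = Omega0_plus \<alpha> \<beta>"
    using strings_eq_itin_False strings_eq_itin_True Omega0_minus_eq Omega0_plus_eq by auto
  moreover have "dot (hat \<Gamma>) = \<Gamma>"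
    using assms by (auto simp: binary_radix_system_def shift_invariant_def dest: spec[of _ 0])
  moreover have "restrict (dec_value B) \<Gamma> = \<pi>"
    using assms by (auto simp: binary_radix_system_def fun_eq_iff restrict_def PiE_def extensional_def)
  ultimately have "R_minus \<alpha> \<beta> = (\<Gamma>, \<pi>, B) \<or> R_plus \<alpha> \<beta> = (\<Gamma>, \<pi>, B)"
    by (auto simp: R_minus_def R_plus_def pair_base_eq)
  then show ?thesis using admissible_pair not_null_pair by blast
qed

end
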